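(* Let $K=2^m$ with $m\ge2$, let $L\in\mathbb{N}$, and let $a(t)\in\mathbb{R}^{K-1}$ evolve according to $$\frac{da_i}{dt}=\frac{1}{D}b_ia_i^{\frac{2L}{L+1}},\qquad b_i=\sum_{j=1}^{K-1}\Psi_{ij}e^{-(\Psi a)_j},\quad D=1+\sum_{j=1}^{K-1}e^{-(\Psi a)_j},$$ with $a_i(0)>0$ for all $i$. Then: (i) the direction $\hat a^*=\frac{1}{K-1}1_{K-1}$ is stable when $\|a\|_1>\frac{L-1}{L+1}(K-1)$ and unstable when $\|a\|_1<\frac{L-1}{L+1}(K-1)$; (ii) if $L>1$, there exists a direction $\hat a^{**}$ having some coordinates equal to zero (a lower-rank structure), and a threshold $\tau>0$, such that $\hat a^{**}$ is stable whenever $\|a\|_1>\tau$; (iii) if $L>1$, the quantity $D_{\mathrm{KL}}\big(\tfrac{1}{K-1}1_{K-1}\,\|\,\hat a(t)\big)$ is not monotonically decreasing along all trajectories, and there exist trajectories with strictly positive initialization along which it diverges to $+\infty$ as $t\to\infty$.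
   Context: Sylvester Hadamard matrices: $\Phi_1=(1)$, $\Phi_{2^m}=\begin{bmatrix}\Phi_{2^{m-1}}&\Phi_{2^{m-1}}\\ \Phi_{2^{m-1}}&-\Phi_{2^{m-1}}\end{bmatrix}$, with $\Phi=\Phi_K$. $\Psi\in\mathbb{R}^{(K-1)\times(K-1)}$ is obtained from $1_K1_K^T-\Phi$ by deleting its first row and column. $\|a\|_1=\sum_i|a_i|$ and $\hat a=a/\|a\|_1$ is the direction. A direction $\hat a^*$ is called stable (in a region of $\|a\|_1$) if, whenever $\hat a$ is sufficiently close to $\hat a^*$ (and $\|a\|_1$ lies in that region), the Euclidean distance from $\hat a$ to $\hat a^*$ decreases under the flow; unstable otherwise. $D_{\mathrm{KL}}(\frac{1}{K-1}1_{K-1}\|\hat a)=-\log(K-1)-\frac{1}{K-1}\sum_i\log\hat a_i$. *)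

theory Defs
  imports "HOL-Analysis.Analysis"
begin

text \<open>Sylvester Hadamard matrix of size 2^m, 0-indexed: entries for i, j < 2^m.\<close>
fun sylv :: "nat \<Rightarrow> nat \<Rightarrow> nat \<Rightarrow> real" where
  "sylv 0 i j = 1"
| "sylv (Suc m) i j =
     (if i < 2^m then (if j < 2^m then sylv m i j else sylv m i (j - 2^m))
      else (if j < 2^m then sylv m (i - 2^m) j else - sylv m (i - 2^m) (j - 2^m)))"

text \<open>Dimension K-1 with K = 2^m. Vectors in R^(K-1) are functions nat => real,
  only indices i < K-1 matter (index i here corresponds to index i+1 in the paper).\<close>
definition dimK1 :: "nat \<Rightarrow> nat" where "dimK1 m = 2^m - 1"

text \<open>Psi: 1 1^T - Phi with first row and column deleted.\<close>
definition Psi :: "nat \<Rightarrow> nat \<Rightarrow> nat \<Rightarrow> real" where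
  "Psi m i j = 1 - sylv m (i + 1) (j + 1)"

definition Psi_a :: "nat \<Rightarrow> (nat \<Rightarrow> real) \<Rightarrow> nat \<Rightarrow> real" where
  "Psi_a m a j = (\<Sum>k<dimK1 m. Psi m j k * a k)"

definition bvec :: "nat \<Rightarrow> (nat \<Rightarrow> real) \<Rightarrow> nat \<Rightarrow> real" where
  "bvec m a i = (\<Sum>j<dimK1 m. Psi m i j * exp (- Psi_a m a j))"

definition Dnorm :: "nat \<Rightarrow> (nat \<Rightarrow> real) \<Rightarrow> real" where
  "Dnorm m a = 1 + (\<Sum>j<dimK1 m. exp (- Psi_a m a j))"

definition field :: "nat \<Rightarrow> nat \<Rightarrow> (nat \<Rightarrow> real) \<Rightarrow> nat \<Rightarrow> real" where
  "field m L a i = bvec m a i * a i powr (2 * real L / (real L + 1)) / Dnorm m a"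

definition l1norm :: "nat \<Rightarrow> (nat \<Rightarrow> real) \<Rightarrow> real" where
  "l1norm m a = (\<Sum>i<dimK1 m. \<bar>a i\<bar>)"

definition direction :: "nat \<Rightarrow> (nat \<Rightarrow> real) \<Rightarrow> nat \<Rightarrow> real" where
  "direction m a = (\<lambda>i. a i / l1norm m a)"

definition edist :: "nat \<Rightarrow> (nat \<Rightarrow> real) \<Rightarrow> (nat \<Rightarrow> real) \<Rightarrow> real" where
  "edist m x y = sqrt (\<Sum>i<dimK1 m. (x i - y i)^2)"

definition positive_state :: "nat \<Rightarrow> (nat \<Rightarrow> real) \<Rightarrow> bool" where
  "positive_state m a \<longleftrightarrow> (\<forall>i<dimK1 m. a i > 0)"

definition is_direction :: "nat \<Rightarrow> (nat \<Rightarrow> real) \<Rightarrow> bool" where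
  "is_direction m x \<longleftrightarrow> (\<forall>i<dimK1 m. x i \<ge> 0) \<and> (\<Sum>i<dimK1 m. x i) = 1"

definition uniform_dir :: "nat \<Rightarrow> nat \<Rightarrow> real" where
  "uniform_dir m = (\<lambda>i. 1 / real (dimK1 m))"

definition dist_decreases :: "nat \<Rightarrow> nat \<Rightarrow> (nat \<Rightarrow> real) \<Rightarrow> (nat \<Rightarrow> real) \<Rightarrow> bool" where
  "dist_decreases m L astar a \<longleftrightarrow>
     (\<exists>d. ((\<lambda>t. edist m (direction m (\<lambda>i. a i + t * field m L a i)) astar)
            has_real_derivative d) (at 0) \<and> d < 0)"

definition stable_at :: "nat \<Rightarrow> nat \<Rightarrow> (nat \<Rightarrow> real) \<Rightarrow> real \<Rightarrow> bool" where
  "stable_at m L astar r \<longleftrightarrow>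
     (\<exists>\<epsilon>>0. \<forall>a. positive_state m a \<and> l1norm m a = r
        \<and> 0 < edist m (direction m a) astar \<and> edist m (direction m a) astar < \<epsilon>
        \<longrightarrow> dist_decreases m L astar a)"

definition stable_in :: "nat \<Rightarrow> nat \<Rightarrow> (nat \<Rightarrow> real) \<Rightarrow> real set \<Rightarrow> bool" where
  "stable_in m L astar R \<longleftrightarrow> (\<forall>r\<in>R. stable_at m L astar r)"

definition unstable_in :: "nat \<Rightarrow> nat \<Rightarrow> (nat \<Rightarrow> real) \<Rightarrow> real set \<Rightarrow> bool" where
  "unstable_in m L astar R \<longleftrightarrow> (\<forall>r\<in>R. \<not> stable_at m L astar r)"

definition trajectory :: "nat \<Rightarrow> nat \<Rightarrow> (real \<Rightarrow> nat \<Rightarrow> real) \<Rightarrow> bool" where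
  "trajectory m L x \<longleftrightarrow>
     positive_state m (x 0) \<and>
     (\<forall>t\<ge>0. \<forall>i<dimK1 m. ((\<lambda>s. x s i) has_real_derivative field m L (x t) i) (at t within {0..}))"

definition KL_unif :: "nat \<Rightarrow> (nat \<Rightarrow> real) \<Rightarrow> real" where
  "KL_unif m ahat = - ln (real (dimK1 m)) - (1 / real (dimK1 m)) * (\<Sum>i<dimK1 m. ln (ahat i))"

end

theory Submission
  imports Defs "HOL-Library.Landau_Symbols"
begin

text \<open>Write p = 2L/(L+1), n = K-1. The matrix Psi has row sums K and Psi^2 = K (J + I) with J the all-ones
  matrix, so Psi^2 acts as K on perturbations d with zero sum. Near the uniform direction the squared
  distance |d|^2 therefore changes at a rate that is a positive multiple of
  ((p-1) n - r) |d|^2 + o(|d|^2), where r is the l1 norm; this gives the threshold. At a coordinate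
  direction the other coordinates move with the superlinear power p > 1 and are outgrown by the
  rescaling, whatever the value of r.

  For the divergence of the KL term, states that take one value v on the nonzero part of an index-two
  subgroup of the index group and another value u off it form an invariant plane. On it
  v' / v^p is at most 2 u' / u^p, so for a small initial v the coordinate v stays bounded while u
  tends to infinity.\<close>

section \<open>Sylvester matrices\<close>

text \<open>\<open>dist_decreases\<close> differentiates along the straight line
  \<open>a + t * field\<close>, so both stability claims are sign computations at a single state;
  only the last claim needs a solution, and on the whole half-line. In the threshold the power
  contributes p n, the renormalisation by the l1 norm takes off n, and the exponentials contribute -
  r through Psi^2. The obstacle in the last claim is existence for all times, since
  \<open>a i powr p\<close> is superlinear. On the invariant plane the \<open>u\<close> equation
  carries a factor exp (- M u) that tames the power. The planar field is clipped to a region where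
  it is globally Lipschitz, and the comparison of v with u shows afterwards that the solution stays
  in that region. The plane is invariant because the rows of the Sylvester matrix are the characters
  of (Z/2)^m: summed over an index-two subgroup or over its complement, all nontrivial characters
  but one give zero.\<close>

lemma sylv_cases: "sylv m i j = 1 \<or> sylv m i j = - 1"
proof (induction m arbitrary: i j)
  case (Suc m)
  show ?case using Suc[of i j] Suc[of i "j - 2^m"] Suc[of "i - 2^m" j] Suc[of "i - 2^m" "j - 2^m"]
    by auto
qed simp

lemma sylv_sym: "sylv m i j = sylv m j i"
  by (induction m arbitrary: i j) auto

lemma sylv_zero_left [simp]: "sylv m 0 j = 1"
  by (induction m arbitrary: j) auto

lemma sylv_zero_right [simp]: "sylv m j 0 = 1"
  by (simp add: sylv_sym[of m j 0])

lemma sum_lessThan_double: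
  fixes f :: "nat \<Rightarrow> real"
  shows "(\<Sum>k<2 * N. f k) = (\<Sum>k<N. f k) + (\<Sum>k<N. f (N + k))"
proof -
  have "(\<Sum>k<2 * N. f k) = sum f {0..<N} + sum f {N..<2*N}"
    by (simp add: sum.atLeastLessThan_concat lessThan_atLeast0)
  also have "sum f {N..<2*N} = (\<Sum>k<N. f (N + k))"
    using sum.shift_bounds_nat_ivl[of f 0 N N] by (simp add: mult_2 add.commute lessThan_atLeast0)
  finally show ?thesis by (simp add: lessThan_atLeast0)
qed

text \<open>The second half of a row repeats the first up to sign, so the sum is (1 + s t) times the
  inner product of the rows i', j' one level down. The factor vanishes when i and j lie in different
  halves, which settles the case of equal residues.\<close>

lemma sylv_orthogonal:
  assumes "i < 2^m" "j < 2^m"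
  shows "(\<Sum>k<2^m. sylv m i k * sylv m j k) = (if i = j then 2^m else 0)"
  using assms
proof (induction m arbitrary: i j)
  case (Suc m)
  let ?N = "2^m :: nat"
  define i' where "i' = (if i < ?N then i else i - ?N)"
  define j' where "j' = (if j < ?N then j else j - ?N)"
  define s where "s = (if i < ?N then 1 else - 1 :: real)"
  define t where "t = (if j < ?N then 1 else - 1 :: real)"
  have lt: "i' < ?N" "j' < ?N" using Suc.prems by (auto simp: i'_def j'_def)
  have "(\<Sum>k<2^Suc m. sylv (Suc m) i k * sylv (Suc m) j k)
      = (\<Sum>k<?N. sylv m i' k * sylv m j' k) + (\<Sum>k<?N. s * t * (sylv m i' k * sylv m j' k))"
    unfolding power_Suc sum_lessThan_double
    by (intro arg_cong2[where f="(+)"] sum.cong) (auto simp: i'_def j'_def s_def t_def)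
  also have "\<dots> = (1 + s * t) * (if i' = j' then 2^m else 0)"
    using Suc.IH[OF lt] by (simp add: sum_distrib_left[symmetric] algebra_simps)
  also have "\<dots> = (if i = j then 2^Suc m else 0)"
    using Suc.prems by (auto simp: i'_def j'_def s_def t_def)
  finally show ?case .
qed simp

lemma sylv_row_sum:
  assumes "i < 2^m"
  shows "(\<Sum>k<2^m. sylv m i k) = (if i = 0 then 2^m else 0)"
  using sylv_orthogonal[OF assms, of 0] by simp

section \<open>Row sums and square of the matrix \<open>Psi\<close>\<close>

lemma Suc_dimK1 [simp]: "Suc (dimK1 m) = 2^m"
  by (simp add: dimK1_def)

lemma less_dimK1_iff: "i < dimK1 m \<longleftrightarrow> i + 1 < 2^m"
  by (auto simp: dimK1_def)

text \<open>Deleting the first row and column is harmless: 1 - sylv vanishes there, so sums can run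
  over all \<open>2^m\<close> indices, where orthogonality applies.\<close>

lemma sum_dimK1_shift:
  fixes f :: "nat \<Rightarrow> real"
  assumes "f 0 = 0"
  shows "(\<Sum>j<dimK1 m. f (j + 1)) = (\<Sum>j<2^m. f j)"
  using sum.lessThan_Suc_shift[of f "dimK1 m"] assms by simp

lemma real_dimK1: "real (dimK1 m) = 2^m - 1"
  by (simp add: dimK1_def of_nat_diff)

lemma dimK1_pos: "m \<ge> 1 \<Longrightarrow> dimK1 m > 0"
  by (metis dimK1_def less_le_trans one_less_numeral_iff one_less_power semiring_norm(76) zero_less_diff zero_less_one)

lemma Psi_nonneg: "Psi m i j \<ge> 0" and Psi_le_2: "Psi m i j \<le> 2"
  using sylv_cases[of m "i+1" "j+1"] by (auto simp: Psi_def)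

lemma Psi_row_sum:
  assumes "i < dimK1 m"
  shows "(\<Sum>j<dimK1 m. Psi m i j) = 2^m"
proof -
  have "(\<Sum>j<dimK1 m. Psi m i j) = (\<Sum>j<2^m. 1 - sylv m (i + 1) j)"
    unfolding Psi_def by (rule sum_dimK1_shift) simp
  also have "\<dots> = 2^m"
    using sylv_row_sum[of "i+1" m] assms by (simp add: sum_subtractf less_dimK1_iff)
  finally show ?thesis .
qed

text \<open>In the expanded product the constant contributes K, the row sums vanish because rows
  \<open>i + 1\<close> and \<open>k + 1\<close> differ from row 0, and orthogonality contributes K
  on the diagonal.\<close>

lemma Psi_square:
  assumes "i < dimK1 m" "k < dimK1 m"
  shows "(\<Sum>j<dimK1 m. Psi m i j * Psi m j k) = 2^m * (1 + (if i = k then 1 else 0))"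
proof -
  have "(\<Sum>j<dimK1 m. Psi m i j * Psi m j k)
      = (\<Sum>j<2^m. (1 - sylv m (i + 1) j) * (1 - sylv m (k + 1) j))"
    unfolding Psi_def sylv_sym[of m _ "k + 1"]
    by (rule sum_dimK1_shift[where f = "\<lambda>j. (1 - sylv m (i + 1) j) * (1 - sylv m (k + 1) j)"]) simp
  also have "\<dots> = (\<Sum>j<2^m. 1 - sylv m (i + 1) j - sylv m (k + 1) j + sylv m (i + 1) j * sylv m (k + 1) j)"
    by (intro sum.cong) (auto simp: algebra_simps)
  also have "\<dots> = 2^m * (1 + (if i = k then 1 else 0))"
    using sylv_row_sum[of "i+1" m] sylv_row_sum[of "k+1" m] sylv_orthogonal[of "i+1" m "k+1"] assms
    by (simp add: sum_subtractf sum.distrib less_dimK1_iff)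
  finally show ?thesis .
qed

lemma Psi_square_sum_zero:
  assumes "i < dimK1 m" "(\<Sum>k<dimK1 m. d k) = 0"
  shows "(\<Sum>j<dimK1 m. Psi m i j * Psi_a m d j) = 2^m * d i"
proof -
  have "(\<Sum>j<dimK1 m. Psi m i j * Psi_a m d j)
      = (\<Sum>k<dimK1 m. (\<Sum>j<dimK1 m. Psi m i j * Psi m j k) * d k)"
    unfolding Psi_a_def sum_distrib_left sum_distrib_right
    by (subst sum.swap) (simp add: algebra_simps)
  also have "\<dots> = (\<Sum>k<dimK1 m. 2^m * (1 + (if i = k then 1 else 0)) * d k)"
    using assms(1) by (intro sum.cong) (auto simp: Psi_square)
  also have "\<dots> = 2^m * (\<Sum>k<dimK1 m. d k) + 2^m * (\<Sum>k<dimK1 m. if i = k then d k else 0)"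
    unfolding sum_distrib_left sum.distrib[symmetric] by (intro sum.cong) (auto simp: algebra_simps)
  also have "\<dots> = 2^m * d i"
    using assms by simp
  finally show ?thesis .
qed

section \<open>Derivative of the distance between directions\<close>

lemma l1norm_positive: "positive_state m a \<Longrightarrow> l1norm m a = (\<Sum>i<dimK1 m. a i)"
  unfolding l1norm_def positive_state_def by (intro sum.cong) auto

lemma DERIV_abs_pos:
  fixes x :: real
  assumes "x > 0"
  shows "(abs has_real_derivative 1) (at x)"
proof -
  have "eventually (\<lambda>y. y \<in> {0<..}) (nhds x)"
    using assms by (intro eventually_nhds_in_open) auto
  then have "eventually (\<lambda>y. \<bar>y\<bar> = y) (nhds x)"
    by eventually_elim auto
  then show ?thesis
    using DERIV_ident[of "at x"] by (subst DERIV_cong_ev[OF refl _ refl, where g = "\<lambda>y. y"])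
qed

lemma l1norm_pos:
  assumes "positive_state m a" "m \<ge> 1"
  shows "l1norm m a > 0"
  unfolding l1norm_positive[OF assms(1)] using assms dimK1_pos[of m]
  by (intro sum_pos) (auto simp: positive_state_def)

text \<open>By the quotient rule each direction coordinate has velocity (f i - x i * S) / r.
  Positivity of the state makes the absolute values in \<open>l1norm\<close> differentiable; the
  nonzero distance does the same for the square root.\<close>

lemma edist_direction_has_derivative:
  fixes f :: "nat \<Rightarrow> real"
  assumes pos: "positive_state m a" and m: "m \<ge> 1"
    and nz: "0 < edist m (direction m a) s"
  defines "x \<equiv> direction m a" and "S \<equiv> (\<Sum>i<dimK1 m. f i)"
  shows "((\<lambda>t. edist m (direction m (\<lambda>i. a i + t * f i)) s) has_real_derivative
      (\<Sum>i<dimK1 m. (x i - s i) * (f i - x i * S)) / (l1norm m a * edist m x s)) (at 0)"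
proof -
  define r where "r = l1norm m a"
  have r: "r > 0"
    unfolding r_def using l1norm_pos[OF pos m] .
  have 1: "((\<lambda>t. l1norm m (\<lambda>i. a i + t * f i)) has_real_derivative S) (at 0)"
    unfolding l1norm_def S_def
  proof (rule DERIV_sum)
    fix i assume "i \<in> {..<dimK1 m}"
    then have "a i > 0" using pos by (auto simp: positive_state_def)
    then show "((\<lambda>t. \<bar>a i + t * f i\<bar>) has_real_derivative f i) (at 0)"
      by (intro DERIV_chain2[where f = abs and g = "\<lambda>t. a i + t * f i" and Da = 1, simplified])
        (auto intro!: derivative_eq_intros DERIV_abs_pos)
  qed
  have 2: "((\<lambda>t. (a i + t * f i) / l1norm m (\<lambda>i. a i + t * f i)) has_real_derivative
       (f i - x i * S) / r) (at 0)" for i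
    using r by (auto intro!: derivative_eq_intros 1 simp: x_def direction_def r_def divide_simps algebra_simps)
  have 3: "((\<lambda>t. \<Sum>i<dimK1 m. ((a i + t * f i) / l1norm m (\<lambda>i. a i + t * f i) - s i)\<^sup>2) has_real_derivative
       (\<Sum>i<dimK1 m. 2 * ((x i - s i) * ((f i - x i * S) / r)))) (at 0)"
  proof (rule DERIV_sum)
    fix i
    show "((\<lambda>t. ((a i + t * f i) / l1norm m (\<lambda>i. a i + t * f i) - s i)\<^sup>2) has_real_derivative
       2 * ((x i - s i) * ((f i - x i * S) / r))) (at 0)"
      using DERIV_power[OF DERIV_diff[OF 2[of i] DERIV_const[of "s i"]], of 2]
      by (simp add: x_def direction_def mult_ac)
  qed
  have pos2: "(\<Sum>i<dimK1 m. (x i - s i)\<^sup>2) > 0"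
    using nz by (simp add: edist_def x_def)
  have "((\<lambda>t. sqrt (\<Sum>i<dimK1 m. ((a i + t * f i) / l1norm m (\<lambda>i. a i + t * f i) - s i)\<^sup>2)) has_real_derivative
       (inverse (edist m x s) / 2) * (\<Sum>i<dimK1 m. 2 * ((x i - s i) * ((f i - x i * S) / r)))) (at 0)"
    by (rule DERIV_chain2[OF _ 3]) (use pos2 in \<open>auto intro!: derivative_eq_intros simp: x_def direction_def edist_def\<close>)
  moreover have "(\<Sum>i<dimK1 m. 2 * ((x i - s i) * ((f i - x i * S) / r)))
      = 2 / r * (\<Sum>i<dimK1 m. (x i - s i) * (f i - x i * S))"
    unfolding sum_distrib_left by (intro sum.cong) auto
  moreover have "(\<lambda>t. edist m (direction m (\<lambda>i. a i + t * f i)) s)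
      = (\<lambda>t. sqrt (\<Sum>i<dimK1 m. ((a i + t * f i) / l1norm m (\<lambda>i. a i + t * f i) - s i)\<^sup>2))"
    by (simp add: edist_def direction_def)
  ultimately show ?thesis
    by (simp add: field_simps r_def)
qed

text \<open>Derivatives are unique, so the existential in \<open>dist_decreases\<close> speaks of
  one number, and its positive denominator does not affect the sign.\<close>

lemma dist_decreases_iff:
  assumes pos: "positive_state m a" and m: "m \<ge> 1"
    and nz: "0 < edist m (direction m a) s"
  shows "dist_decreases m L s a \<longleftrightarrow>
     (\<Sum>i<dimK1 m. (direction m a i - s i) *
        (field m L a i - direction m a i * (\<Sum>j<dimK1 m. field m L a j))) < 0"
proof -
  have r: "l1norm m a > 0"
    by (rule l1norm_pos[OF pos m])
  have "dist_decreases m L s a \<longleftrightarrow>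
     (\<Sum>i<dimK1 m. (direction m a i - s i) *
        (field m L a i - direction m a i * (\<Sum>j<dimK1 m. field m L a j)))
       / (l1norm m a * edist m (direction m a) s) < 0"
    unfolding dist_decreases_def
    using edist_direction_has_derivative[OF pos m nz, of "field m L a"] DERIV_unique by blast
  moreover have "l1norm m a * edist m (direction m a) s > 0"
    using r nz by simp
  ultimately show ?thesis by (simp add: pos_divide_less_eq)
qed

lemma sum_direction:
  assumes "positive_state m a" "m \<ge> 1"
  shows "(\<Sum>i<dimK1 m. direction m a i) = 1"
  using l1norm_pos[OF assms]
  by (simp add: direction_def sum_divide_distrib[symmetric] l1norm_positive[OF assms(1), symmetric])

lemma Dnorm_ge_1: "Dnorm m a \<ge> 1"
  by (simp add: Dnorm_def sum_nonneg)

section \<open>Coordinate directions\<close>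

lemma edist_component:
  assumes "i < dimK1 m"
  shows "\<bar>x i - y i\<bar> \<le> edist m x y"
  unfolding edist_def
  using assms by (intro real_le_rsqrt) (auto intro!: member_le_sum simp flip: sum_power2_eq_zero_iff)

lemma Psi_a_bounds:
  assumes "positive_state m a"
  shows "0 \<le> Psi_a m a j" "Psi_a m a j \<le> 2 * l1norm m a"
  using assms unfolding Psi_a_def l1norm_positive[OF assms] sum_distrib_left positive_state_def
  by (auto intro!: sum_nonneg sum_mono mult_nonneg_nonneg mult_right_mono simp: Psi_nonneg Psi_le_2 less_imp_le)

text \<open>At fixed l1 norm the coefficients lie between positive constants independent of the
  direction, so near a vertex only the powers of the coordinates matter.\<close>

lemma bvec_bounds:
  assumes "positive_state m a" "i < dimK1 m"
  shows "2^m * exp (- 2 * l1norm m a) \<le> bvec m a i" "bvec m a i \<le> 2^m"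
proof -
  have "2^m * exp (- 2 * l1norm m a) = (\<Sum>j<dimK1 m. Psi m i j * exp (- 2 * l1norm m a))"
    using Psi_row_sum[OF assms(2)] by (simp flip: sum_distrib_right)
  also have "\<dots> \<le> bvec m a i"
    unfolding bvec_def using Psi_a_bounds(2)[OF assms(1)]
    by (intro sum_mono mult_left_mono) (auto simp: Psi_nonneg)
  finally show "2^m * exp (- 2 * l1norm m a) \<le> bvec m a i" .
  have "bvec m a i \<le> (\<Sum>j<dimK1 m. Psi m i j * 1)"
    unfolding bvec_def using Psi_a_bounds(1)[OF assms(1)]
    by (intro sum_mono mult_left_mono) (auto simp: Psi_nonneg)
  then show "bvec m a i \<le> 2^m" using Psi_row_sum[OF assms(2)] by simp
qed

lemma vertex_direction_stable:
  assumes m: "m \<ge> 2" and L: "L > 1" and r: "r > 0"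
  defines "s \<equiv> \<lambda>i::nat. if i = 0 then 1 else 0 :: real"
  shows "stable_at m L s r"
proof -
  define p where "p = 2 * real L / (real L + 1)"
  have p: "1 < p" "p < 2" using L by (auto simp: p_def field_simps)
  \<comment> \<open>\<open>exp (- 2 * r)\<close> bounds b_0 / K from below, and 1/4 bounds
    \<open>x 0 powr p\<close> from below once \<open>x 0\<close> is at least 1/2, as p < 2.\<close>
  define C where "C = exp (- 2 * r) / 4"
  have C: "C > 0" by (simp add: C_def)
  \<comment> \<open>The first bound gives \<open>x 0\<close> at least 1/2; the second gives
    \<open>x i powr (p - 1) < C\<close> for the other coordinates.\<close>
  define \<epsilon> where "\<epsilon> = min (1/2) (C powr (1 / (p - 1)))"
  have \<epsilon>: "\<epsilon> > 0" using C by (simp add: \<epsilon>_def)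
  have n: "0 < dimK1 m" "1 < dimK1 m"
    using power_increasing[OF m, of "2::nat"] by (auto simp: dimK1_def)
  have "dist_decreases m L s a"
    if pos: "positive_state m a" and ra: "l1norm m a = r"
      and d: "0 < edist m (direction m a) s" "edist m (direction m a) s < \<epsilon>" for a
  proof -
    define x where "x = direction m a"
    define f where "f = field m L a"
    define S where "S = (\<Sum>j<dimK1 m. f j)"
    have a_eq: "a i = r * x i" for i
      using r by (simp add: x_def direction_def ra)
    have xpos: "x i > 0" if "i < dimK1 m" for i
      using that pos r by (auto simp: x_def direction_def ra positive_state_def)
    have x_sum: "(\<Sum>i<dimK1 m. x i) = 1"
      using sum_direction[OF pos] m by (simp add: x_def)
    have x0: "1/2 \<le> x 0" "x 0 \<le> 1"
    proof -
      show "1/2 \<le> x 0"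
        using edist_component[OF n(1), of x s] d by (auto simp: x_def s_def \<epsilon>_def)
      have "x 0 \<le> (\<Sum>i<dimK1 m. x i)"
        using n xpos by (intro member_le_sum) (auto intro: less_imp_le)
      then show "x 0 \<le> 1" by (simp add: x_sum)
    qed
    have f_eq: "f i = r powr p / Dnorm m a * (bvec m a i * x i powr p)" if "i < dimK1 m" for i
      using r xpos[OF that] by (simp add: f_def field_def p_def a_eq powr_mult)
    define c where "c = r powr p / Dnorm m a"
    have c: "c > 0" using r Dnorm_ge_1[of m a] by (simp add: c_def)
    have bpos: "bvec m a i > 0" if "i < dimK1 m" for i
      using bvec_bounds(1)[OF pos that] by (smt (verit) exp_gt_zero mult_pos_pos zero_less_power)
    have fpos: "f i > 0" if "i < dimK1 m" for i
      using c bpos[OF that] xpos[OF that] by (simp add: f_eq[OF that] flip: c_def)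
    have f0: "f 0 \<ge> c * (2^m * C)"
    proof -
      have "(1/2) powr 2 \<le> (1/2) powr p" using p by (intro powr_mono') auto
      also have "(1/2) powr p \<le> x 0 powr p" using x0 p by (intro powr_mono2) auto
      finally have "1/4 \<le> x 0 powr p" by (simp add: power2_eq_square)
      then have "(2^m * exp (- 2 * r)) * (1/4) \<le> bvec m a 0 * x 0 powr p"
        using bvec_bounds(1)[OF pos n(1)] by (intro mult_mono) (auto simp: ra intro: less_imp_le[OF bpos[OF n(1)]])
      then show ?thesis using c by (simp add: f_eq[OF n(1)] C_def flip: c_def)
    qed
    have S: "f 0 \<le> S"
      unfolding S_def using n fpos by (intro member_le_sum) (auto intro: less_imp_le)
    have neg: "f i - x i * S < 0" if i: "i < dimK1 m" "i \<noteq> 0" for i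
    proof -
      have "x i < C powr (1 / (p - 1))"
        using edist_component[OF i(1), of x s] d i by (auto simp: x_def s_def \<epsilon>_def)
      then have "x i powr (p - 1) < (C powr (1 / (p - 1))) powr (p - 1)"
        using p xpos[OF i(1)] by (intro powr_less_mono2) auto
      also have "\<dots> = C" using p C by (simp add: powr_powr)
      finally have *: "x i powr (p - 1) < C" .
      have "x i powr p = x i powr (1 + (p - 1))" by simp
      also have "\<dots> = x i * x i powr (p - 1)"
        using xpos[OF i(1)] by (subst powr_add) simp
      finally have xp: "x i powr p = x i * x i powr (p - 1)" .
      have "bvec m a i * x i powr (p - 1) \<le> 2^m * x i powr (p - 1)"
        using bvec_bounds(2)[OF pos i(1)] by (intro mult_right_mono) auto
      also have "\<dots> < 2^m * C" using * by simp
      finally have "x i * c * (bvec m a i * x i powr (p - 1)) < x i * c * (2^m * C)"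
        using xpos[OF i(1)] c by (intro mult_strict_left_mono) auto
      then have "f i < x i * (c * (2^m * C))"
        by (simp add: f_eq[OF i(1)] xp mult_ac flip: c_def)
      also have "\<dots> \<le> x i * S"
        using xpos[OF i(1)] f0 S by (intro mult_left_mono) auto
      finally show ?thesis by simp
    qed
    let ?I = "{..<dimK1 m} - {0}"
    \<comment> \<open>The projected field is tangent to the simplex: once it is negative at all
      other coordinates, it must be nonnegative at coordinate 0.\<close>
    have tot: "(\<Sum>i<dimK1 m. f i - x i * S) = 0"
      by (simp add: sum_subtractf x_sum S_def flip: sum_distrib_right)
    have split: "(\<Sum>i<dimK1 m. h i) = h 0 + sum h ?I" for h :: "nat \<Rightarrow> real"
      using n by (intro sum.remove) auto
    have "(\<Sum>i\<in>?I. f i - x i * S) \<le> 0"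
      using neg by (intro sum_nonpos) (auto intro: less_imp_le)
    then have z: "f 0 - x 0 * S \<ge> 0"
      using tot unfolding split by linarith
    have "(\<Sum>i\<in>?I. (x i - s i) * (f i - x i * S)) < 0"
    proof -
      have "(\<Sum>i\<in>?I. (x i - s i) * (f i - x i * S)) < (\<Sum>i\<in>?I. 0)"
      proof (rule sum_strict_mono)
        show "?I \<noteq> {}" using n by (auto intro!: exI[of _ 1])
      qed (use neg xpos in \<open>auto simp: s_def mult_pos_neg\<close>)
      then show ?thesis by simp
    qed
    moreover have "(x 0 - s 0) * (f 0 - x 0 * S) \<le> 0"
      using z x0 by (intro mult_nonpos_nonneg) (auto simp: s_def)
    ultimately have "(\<Sum>i<dimK1 m. (x i - s i) * (f i - x i * S)) < 0"
      unfolding split by linarith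
    then show ?thesis
      using dist_decreases_iff[OF pos _ d(1), of L] m by (simp add: x_def f_def S_def)
  qed
  then show ?thesis
    unfolding stable_at_def using \<epsilon> by blast
qed

section \<open>The uniform direction\<close>

text \<open>Differentiability gives an error o(X), which the bound X = O(g) turns into o(g). Stated
  over any filter, so that X can be a coordinate or a component of \<open>Psi_a\<close>.\<close>

lemma smallo_linearization:
  fixes X :: "'a \<Rightarrow> real" and g :: "'a \<Rightarrow> real"
  assumes "(\<phi> has_real_derivative c) (at 0)" "X \<in> O[F](g)" "(X \<longlongrightarrow> 0) F"
  shows "(\<lambda>x. \<phi> (X x) - \<phi> 0 - c * X x) \<in> o[F](g)"
proof -
  have "(\<lambda>x. \<phi> (X x) - \<phi> 0 - c * X x) \<in> o[F](X)"
  proof (rule landau_o.smallI)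
    fix e :: real assume "e > 0"
    then obtain d where d: "d > 0" "\<And>y. \<bar>y\<bar> < d \<Longrightarrow> \<bar>\<phi> y - \<phi> 0 - c * y\<bar> \<le> e * \<bar>y\<bar>"
      using assms(1) unfolding has_field_derivative_def has_derivative_at_alt by fastforce
    have "eventually (\<lambda>x. \<bar>X x\<bar> < d) F"
      using assms(3) d(1) by (auto simp: tendsto_iff)
    then show "eventually (\<lambda>x. norm (\<phi> (X x) - \<phi> 0 - c * X x) \<le> e * norm (X x)) F"
      by eventually_elim (use d in auto)
  qed
  then show ?thesis using assms(2) by (rule landau_o.small_big_trans)
qed

text \<open>States are bare functions of which only finitely many values count, so smallness is
  measured by \<open>edist\<close> and not by the topology of the function type.
  \<open>at_right 0\<close> excludes distance zero; the principal part keeps differences of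
  directions.\<close>

definition perturbation_filter :: "nat \<Rightarrow> (nat \<Rightarrow> real) filter" where
  "perturbation_filter m =
     inf (filtercomap (\<lambda>d. edist m d (\<lambda>_. 0)) (at_right 0)) (principal {d. (\<Sum>i<dimK1 m. d i) = 0})"

lemma eventually_perturbation_filter:
  "eventually P (perturbation_filter m) \<longleftrightarrow>
     (\<exists>\<epsilon>>0. \<forall>d. (\<Sum>i<dimK1 m. d i) = 0 \<and> 0 < edist m d (\<lambda>_. 0) \<and> edist m d (\<lambda>_. 0) < \<epsilon> \<longrightarrow> P d)"
  unfolding perturbation_filter_def eventually_inf_principal eventually_filtercomap eventually_at_right_field
  by (fastforce intro: exI[of _ "\<lambda>y. 0 < y \<and> y < _"])

lemma edist_zero_sq: "(edist m d (\<lambda>_. 0))\<^sup>2 = (\<Sum>i<dimK1 m. (d i)\<^sup>2)"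
  by (simp add: edist_def sum_nonneg)

text \<open>Up to a positive factor common to all i, \<open>w d i\<close> is the field at the state
  r/n (1 + n d), and N^2 is the inner product of d with the direction 1/n + d. To first order w = K
  + K (p n - r) d; this suffices, because pairing with d turns the o(N) remainder into o(N^2). The
  two sums then give K (p n - r) N^2 and K n N^2.\<close>

lemma uniform_perturbation_expansion:
  fixes p r :: real and m :: nat
  defines "N \<equiv> \<lambda>d. edist m d (\<lambda>_. 0)" and "n \<equiv> real (dimK1 m)"
    and "w \<equiv> \<lambda>d i. (\<Sum>j<dimK1 m. Psi m i j * exp (- r * Psi_a m d j)) * (1 + real (dimK1 m) * d i) powr p"
  shows "(\<lambda>d. (\<Sum>i<dimK1 m. d i * w d i) - (N d)\<^sup>2 * (\<Sum>i<dimK1 m. w d i)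
             - 2^m * ((p - 1) * n - r) * (N d)\<^sup>2) \<in> o[perturbation_filter m](\<lambda>d. (N d)\<^sup>2)"
proof -
  let ?F = "perturbation_filter m"
  have ev0: "eventually (\<lambda>d. (\<Sum>i<dimK1 m. d i) = 0) ?F"
    unfolding eventually_perturbation_filter by (auto intro!: exI[of _ 1])
  have Nlim: "(N \<longlongrightarrow> 0) ?F"
    unfolding tendsto_iff eventually_perturbation_filter N_def by auto
  have N1: "N \<in> o[?F](\<lambda>_. 1)"
    using Nlim by (intro smalloI_tendsto) auto
  have dO: "(\<lambda>d. d i) \<in> O[?F](N)" if "i < dimK1 m" for i
    by (rule landau_o.bigI[of 1])
      (use edist_component[OF that, of _ "\<lambda>_. 0"] in \<open>auto simp: N_def intro!: always_eventually order_trans[OF _ abs_ge_self]\<close>)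
  have PO: "(\<lambda>d. Psi_a m d j) \<in> O[?F](N)" for j
    unfolding Psi_a_def
  proof (rule big_sum_in_bigo)
    fix k assume "k \<in> {..<dimK1 m}"
    then show "(\<lambda>d. Psi m j k * d k) \<in> O[?F](N)"
      by (cases "Psi m j k = 0") (auto simp: dO)
  qed
  have lim0: "(X \<longlongrightarrow> 0) ?F" if "X \<in> O[?F](N)" for X :: "_ \<Rightarrow> real"
    using landau_o.big_small_trans[OF that N1] smalloD_tendsto by fastforce
  define \<beta> where "\<beta> = (\<lambda>d i. \<Sum>j<dimK1 m. Psi m i j * exp (- r * Psi_a m d j))"
  define \<gamma> where "\<gamma> = (\<lambda>d (i::nat). (1 + n * d i) powr p)"
  define R where "R = (\<lambda>d i. w d i - 2^m - 2^m * (p * n - r) * d i)"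
  have w: "w d i = \<beta> d i * \<gamma> d i" for d i
    by (simp add: w_def \<beta>_def \<gamma>_def n_def)
  have R: "(\<lambda>d. R d i) \<in> o[?F](N)" if i: "i < dimK1 m" for i
  proof -
    have "(\<lambda>d. \<Sum>j<dimK1 m. Psi m i j * (exp (- r * Psi_a m d j) - exp (- r * 0) - (- r) * Psi_a m d j)) \<in> o[?F](N)"
    proof (intro big_sum_in_smallo)
      fix j
      have "(\<lambda>d. exp (- r * Psi_a m d j) - exp (- r * 0) - (- r) * Psi_a m d j) \<in> o[?F](N)"
        by (rule smallo_linearization[where \<phi> = "\<lambda>h. exp (- r * h)" and X = "\<lambda>d. Psi_a m d j"])
          (use PO lim0 in \<open>auto intro!: derivative_eq_intros\<close>)
      then show "(\<lambda>d. Psi m i j * (exp (- r * Psi_a m d j) - exp (- r * 0) - (- r) * Psi_a m d j)) \<in> o[?F](N)"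
        by simp
    qed
    \<comment> \<open>The linear term collapses to a multiple of \<open>d i\<close> only for
      perturbations of sum zero, so the two sides agree eventually rather than everywhere.\<close>
    also have "?this \<longleftrightarrow> (\<lambda>d. \<beta> d i - 2^m + 2^m * r * d i) \<in> o[?F](N)"
    proof (rule landau_o.small.in_cong)
      show "eventually (\<lambda>d. (\<Sum>j<dimK1 m. Psi m i j * (exp (- r * Psi_a m d j) - exp (- r * 0) - (- r) * Psi_a m d j))
            = \<beta> d i - 2^m + 2^m * r * d i) ?F"
        using ev0
      proof eventually_elim
        case (elim d)
        have "(\<Sum>j<dimK1 m. Psi m i j * (exp (- r * Psi_a m d j) - exp (- r * 0) - (- r) * Psi_a m d j))
          = \<beta> d i - (\<Sum>j<dimK1 m. Psi m i j) + r * (\<Sum>j<dimK1 m. Psi m i j * Psi_a m d j)"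
          unfolding \<beta>_def sum_distrib_left sum.distrib[symmetric] sum_subtractf[symmetric]
          by (intro sum.cong) (auto simp: algebra_simps)
        then show ?case
          using Psi_row_sum[OF i] Psi_square_sum_zero[OF i elim] by simp
      qed
    qed
    finally have B: "(\<lambda>d. \<beta> d i - 2^m + 2^m * r * d i) \<in> o[?F](N)" .
    have "(\<lambda>d. (1 + n * d i) powr p - (1 + n * 0) powr p - (p * n) * d i) \<in> o[?F](N)"
      by (rule smallo_linearization[where \<phi> = "\<lambda>h. (1 + n * h) powr p" and X = "\<lambda>d. d i"])
         (use dO[OF i] lim0[OF dO[OF i]] in \<open>auto intro!: derivative_eq_intros\<close>)
    then have G: "(\<lambda>d. \<gamma> d i - 1 - p * n * d i) \<in> o[?F](N)"
      by (simp add: \<gamma>_def)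
    have "((\<lambda>d. \<gamma> d i) \<longlongrightarrow> (1 + n * 0) powr p) ?F"
      unfolding \<gamma>_def by (intro tendsto_intros lim0[OF dO[OF i]]) auto
    then have G1: "(\<lambda>d. \<gamma> d i) \<in> O[?F](\<lambda>_. 1)"
      by (intro bigoI_tendsto) auto
    have dsmall: "(\<lambda>d. d i) \<in> o[?F](\<lambda>_. 1)"
      using landau_o.big_small_trans[OF dO[OF i] N1] .
    have K1: "(\<lambda>d. 2^m - 2^m * r * d i) \<in> O[?F](\<lambda>_. 1)"
      using landau_o.small_imp_big[OF dsmall] by (intro sum_in_bigo) auto
    have t1: "(\<lambda>d. (\<beta> d i - 2^m + 2^m * r * d i) * \<gamma> d i) \<in> o[?F](N)"
      using landau_o.small_big_mult[OF B G1] by simp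
    have t2: "(\<lambda>d. (2^m - 2^m * r * d i) * (\<gamma> d i - 1 - p * n * d i)) \<in> o[?F](N)"
      using landau_o.big_small_mult[OF K1 G] by simp
    have t3: "(\<lambda>d. (2^m * r * p * n) * (d i * d i)) \<in> o[?F](N)"
      using landau_o.big_small_mult[OF dO[OF i] dsmall] by simp
    \<comment> \<open>Product of two linearizations: the error of each factor times the other, minus
      the quadratic cross term of the two linear parts.\<close>
    have "R d i = (\<beta> d i - 2^m + 2^m * r * d i) * \<gamma> d i
        + (2^m - 2^m * r * d i) * (\<gamma> d i - 1 - p * n * d i) - (2^m * r * p * n) * (d i * d i)" for d
      by (simp add: R_def w algebra_simps)
    then show ?thesis
      using sum_in_smallo(2)[OF sum_in_smallo(1)[OF t1 t2] t3] by presburger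
  qed
  have A1: "(\<lambda>d. \<Sum>i<dimK1 m. d i * R d i) \<in> o[?F](\<lambda>d. (N d)\<^sup>2)"
    unfolding power2_eq_square
    by (intro big_sum_in_smallo landau_o.big_small_mult dO R) auto
  have "(\<lambda>d. \<Sum>i<dimK1 m. R d i) \<in> o[?F](N)"
    by (intro big_sum_in_smallo R) auto
  then have "(\<lambda>d. \<Sum>i<dimK1 m. R d i) \<in> o[?F](\<lambda>_. 1)"
    using N1 landau_o.small_imp_big landau_o.big_small_trans by blast
  from landau_o.big_small_mult[OF landau_o.big_refl[of "\<lambda>d. (N d)\<^sup>2"] this]
  have A2: "(\<lambda>d. (N d)\<^sup>2 * (\<Sum>i<dimK1 m. R d i)) \<in> o[?F](\<lambda>d. (N d)\<^sup>2)"
    by simp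
  have "(\<lambda>d. (\<Sum>i<dimK1 m. d i * R d i) - (N d)\<^sup>2 * (\<Sum>i<dimK1 m. R d i)) \<in> o[?F](\<lambda>d. (N d)\<^sup>2)"
    using sum_in_smallo(2)[OF A1 A2] .
  also have "?this \<longleftrightarrow> ?thesis"
  proof (rule landau_o.small.in_cong)
    show "eventually (\<lambda>d. (\<Sum>i<dimK1 m. d i * R d i) - (N d)\<^sup>2 * (\<Sum>i<dimK1 m. R d i)
        = (\<Sum>i<dimK1 m. d i * w d i) - (N d)\<^sup>2 * (\<Sum>i<dimK1 m. w d i)
             - 2^m * ((p - 1) * n - r) * (N d)\<^sup>2) ?F"
      using ev0
    proof eventually_elim
      case (elim d)
      have w_eq: "w d i = R d i + 2^m + 2^m * (p * n - r) * d i" for i by (simp add: R_def)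
      have "(\<Sum>i<dimK1 m. d i * w d i)
          = (\<Sum>i<dimK1 m. d i * R d i) + 2^m * (\<Sum>i<dimK1 m. d i) + 2^m * (p * n - r) * (\<Sum>i<dimK1 m. (d i)\<^sup>2)"
        unfolding w_eq sum_distrib_left sum.distrib[symmetric]
        by (intro sum.cong) (auto simp: algebra_simps power2_eq_square)
      also have "\<dots> = (\<Sum>i<dimK1 m. d i * R d i) + 2^m * (p * n - r) * (N d)\<^sup>2"
        using elim by (simp add: N_def edist_zero_sq)
      finally have 1: "(\<Sum>i<dimK1 m. d i * w d i) = \<dots>" .
      have "(\<Sum>i<dimK1 m. w d i)
          = (\<Sum>i<dimK1 m. R d i) + n * 2^m + 2^m * (p * n - r) * (\<Sum>i<dimK1 m. d i)"
        unfolding w_eq by (simp add: sum.distrib sum_distrib_left n_def)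
      then have 2: "(\<Sum>i<dimK1 m. w d i) = (\<Sum>i<dimK1 m. R d i) + n * 2^m"
        using elim by simp
      show ?case unfolding 1 2 by (simp add: algebra_simps)
    qed
  qed
  finally show ?thesis .
qed

text \<open>One equivalence serves both sides of the threshold: close to the uniform direction the
  expansion fixes the sign of the derivative at every state.\<close>

lemma uniform_direction_sign:
  fixes r :: real and m L :: nat
  assumes m: "m \<ge> 2" and r: "r > 0"
  defines "\<kappa> \<equiv> (real L - 1) / (real L + 1) * real (dimK1 m) - r"
  assumes nz: "\<kappa> \<noteq> 0"
  obtains \<epsilon> where "\<epsilon> > 0"
    "\<And>a. positive_state m a \<Longrightarrow> l1norm m a = r \<Longrightarrow> 0 < edist m (direction m a) (uniform_dir m) \<Longrightarrow>
       edist m (direction m a) (uniform_dir m) < \<epsilon> \<Longrightarrow>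
       dist_decreases m L (uniform_dir m) a \<longleftrightarrow> \<kappa> < 0"
proof -
  let ?F = "perturbation_filter m"
  define n where "n = real (dimK1 m)"
  have n: "n > 0" using dimK1_pos[of m] m by (simp add: n_def)
  define p where "p = 2 * real L / (real L + 1)"
  have p1: "(p - 1) * n - r = \<kappa>" by (simp add: p_def \<kappa>_def n_def field_simps)
  define N where "N = (\<lambda>d. edist m d (\<lambda>_. 0))"
  define w where "w = (\<lambda>d i. (\<Sum>j<dimK1 m. Psi m i j * exp (- r * Psi_a m d j)) * (1 + n * d i) powr p)"
  define H where "H = (\<lambda>d. (\<Sum>i<dimK1 m. d i * w d i) - (N d)\<^sup>2 * (\<Sum>i<dimK1 m. w d i))"
  have "(\<lambda>d. H d - 2^m * \<kappa> * (N d)\<^sup>2) \<in> o[?F](\<lambda>d. (N d)\<^sup>2)"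
    using uniform_perturbation_expansion[of m r p] unfolding H_def w_def N_def n_def p1[symmetric] by simp
  \<comment> \<open>Half of \<bar>\<kappa>\<bar> is a safe tolerance, since the leading coefficient
    has modulus 2^m \<bar>\<kappa>\<bar>, at least \<bar>\<kappa>\<bar>.\<close>
  then have "eventually (\<lambda>d. \<bar>H d - 2^m * \<kappa> * (N d)\<^sup>2\<bar> \<le> \<bar>\<kappa>\<bar> / 2 * (N d)\<^sup>2) ?F"
    using nz landau_o.smallD[of _ ?F _ "\<bar>\<kappa>\<bar> / 2"] by fastforce
  then obtain \<epsilon> where \<epsilon>: "\<epsilon> > 0" and
    H: "\<And>d. (\<Sum>i<dimK1 m. d i) = 0 \<Longrightarrow> 0 < N d \<Longrightarrow> N d < \<epsilon> \<Longrightarrow> \<bar>H d - 2^m * \<kappa> * (N d)\<^sup>2\<bar> \<le> \<bar>\<kappa>\<bar> / 2 * (N d)\<^sup>2"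
    unfolding eventually_perturbation_filter N_def by blast
  show ?thesis
  proof (rule that[OF \<epsilon>])
    fix a assume pos: "positive_state m a" and ra: "l1norm m a = r"
      and d1: "0 < edist m (direction m a) (uniform_dir m)" and d2: "edist m (direction m a) (uniform_dir m) < \<epsilon>"
    define d where "d = (\<lambda>i. direction m a i - 1 / n)"
    define f where "f = field m L a"
    define x where "x = direction m a"
    have x: "x i = 1 / n + d i" for i by (simp add: x_def d_def)
    have a_eq: "a i = r / n * (1 + n * d i)" for i
      using r n by (simp add: d_def direction_def ra field_simps)
    have Nd: "N d = edist m (direction m a) (uniform_dir m)"
      by (simp add: N_def edist_def d_def uniform_dir_def n_def)
    have sd: "(\<Sum>i<dimK1 m. d i) = 0"
      using sum_direction[OF pos] m n by (simp add: d_def sum_subtractf n_def)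
    have Pa: "Psi_a m a j = r / n * 2^m + r * Psi_a m d j" if "j < dimK1 m" for j
    proof -
      have "Psi_a m a j = r / n * (\<Sum>k<dimK1 m. Psi m j k) + r * Psi_a m d j"
        unfolding Psi_a_def sum_distrib_left sum.distrib[symmetric] a_eq
        using n by (intro sum.cong) (auto simp: field_simps)
      then show ?thesis using Psi_row_sum[OF that] by simp
    qed
    \<comment> \<open>Everything that does not depend on the coordinate: the scale of the power, the
      exponential at the uniform state, and the normaliser. Only its positivity matters.\<close>
    define c where "c = (r / n) powr p * exp (- (r / n * 2^m)) / Dnorm m a"
    have c: "c > 0" using r n Dnorm_ge_1[of m a] by (simp add: c_def)
    have f: "f i = c * w d i" if "i < dimK1 m" for i
    proof -
      have "bvec m a i = exp (- (r / n * 2^m)) * (\<Sum>j<dimK1 m. Psi m i j * exp (- r * Psi_a m d j))"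
        unfolding bvec_def sum_distrib_left
        by (intro sum.cong) (auto simp: Pa exp_diff exp_minus field_simps simp flip: exp_add)
      moreover have "a i powr p = (r / n) powr p * (1 + n * d i) powr p"
        unfolding a_eq[of i] by (rule powr_mult)
      ultimately show ?thesis
        by (simp add: f_def field_def w_def c_def flip: p_def)
    qed
    have dx: "(\<Sum>i<dimK1 m. d i * x i) = (N d)\<^sup>2"
      using sd unfolding x N_def edist_zero_sq
      by (simp add: distrib_left sum.distrib power2_eq_square flip: sum_divide_distrib)
    have "(\<Sum>i<dimK1 m. (x i - uniform_dir m i) * (f i - x i * (\<Sum>j<dimK1 m. f j)))
        = (\<Sum>i<dimK1 m. d i * f i) - (\<Sum>i<dimK1 m. d i * x i) * (\<Sum>j<dimK1 m. f j)"
      unfolding sum_distrib_right[of _ _ "sum f _"] sum_subtractf[symmetric]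
      by (intro sum.cong) (auto simp: x uniform_dir_def n_def algebra_simps)
    also have "\<dots> = (\<Sum>i<dimK1 m. d i * (c * w d i)) - (N d)\<^sup>2 * (\<Sum>j<dimK1 m. c * w d j)"
      by (simp add: f dx)
    also have "\<dots> = c * H d"
      by (simp add: H_def sum_distrib_left sum_distrib_right algebra_simps)
    finally have eq: "(\<Sum>i<dimK1 m. (x i - uniform_dir m i) * (f i - x i * (\<Sum>j<dimK1 m. f j))) = c * H d" .
    have N2: "(N d)\<^sup>2 > 0" using d1 by (simp add: Nd)
    have m1: "(1::real) \<le> 2^m" by simp
    have b: "\<bar>H d - 2^m * \<kappa> * (N d)\<^sup>2\<bar> \<le> (\<bar>\<kappa>\<bar> * (N d)\<^sup>2) / 2"
      using H[OF sd] d1 d2 by (simp add: Nd)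
    have "H d < 0 \<longleftrightarrow> \<kappa> < 0"
    proof (cases "\<kappa> < 0")
      case True
      have "2^m * \<kappa> * (N d)\<^sup>2 \<le> 1 * \<kappa> * (N d)\<^sup>2"
        using True N2 m1 by (intro mult_right_mono mult_right_mono_neg) auto
      moreover have "\<kappa> * (N d)\<^sup>2 < 0" using True N2 by (simp add: mult_neg_pos)
      moreover have "\<bar>\<kappa>\<bar> * (N d)\<^sup>2 = - (\<kappa> * (N d)\<^sup>2)" using True by simp
      ultimately have "H d < 0" using b unfolding abs_le_iff by linarith
      then show ?thesis using True by simp
    next
      case False
      have "2^m * \<kappa> * (N d)\<^sup>2 \<ge> 1 * \<kappa> * (N d)\<^sup>2"
        using False N2 m1 by (intro mult_right_mono mult_right_mono) auto
      moreover have "\<kappa> * (N d)\<^sup>2 > 0" using False nz N2 by simp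
      moreover have "\<bar>\<kappa>\<bar> * (N d)\<^sup>2 = \<kappa> * (N d)\<^sup>2" using False by simp
      ultimately have "H d > 0" using b unfolding abs_le_iff by linarith
      then show ?thesis using False by simp
    qed
    then show "dist_decreases m L (uniform_dir m) a \<longleftrightarrow> \<kappa> < 0"
      using dist_decreases_iff[OF pos _ d1, of L] m eq c
      by (simp add: x_def f_def mult_less_0_iff)
  qed
qed

lemma uniform_dir_stable:
  assumes "m \<ge> 2" "L \<ge> 1" "r > (real L - 1) / (real L + 1) * real (dimK1 m)"
  shows "stable_at m L (uniform_dir m) r"
proof -
  have "0 \<le> (real L - 1) / (real L + 1) * real (dimK1 m)" using assms(2) by simp
  then have r: "r > 0" using assms(3) by linarith
  from uniform_direction_sign[OF assms(1) r, of L] assms(3)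
  show ?thesis unfolding stable_at_def by (smt (verit))
qed

lemma uniform_dir_unstable:
  assumes m: "m \<ge> 2" and r: "r > 0" and rl: "r < (real L - 1) / (real L + 1) * real (dimK1 m)"
  shows "\<not> stable_at m L (uniform_dir m) r"
proof
  assume "stable_at m L (uniform_dir m) r"
  then obtain \<epsilon>1 where e1: "\<epsilon>1 > 0" and
    st: "\<And>a. positive_state m a \<Longrightarrow> l1norm m a = r \<Longrightarrow> 0 < edist m (direction m a) (uniform_dir m) \<Longrightarrow>
       edist m (direction m a) (uniform_dir m) < \<epsilon>1 \<Longrightarrow> dist_decreases m L (uniform_dir m) a"
    unfolding stable_at_def by blast
  obtain \<epsilon>2 where e2: "\<epsilon>2 > 0" and
    un: "\<And>a. positive_state m a \<Longrightarrow> l1norm m a = r \<Longrightarrow> 0 < edist m (direction m a) (uniform_dir m) \<Longrightarrow>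
       edist m (direction m a) (uniform_dir m) < \<epsilon>2 \<Longrightarrow> \<not> dist_decreases m L (uniform_dir m) a"
    using uniform_direction_sign[OF m r, of L] rl by (smt (verit))
  have n: "0 < dimK1 m" "1 < dimK1 m"
    using power_increasing[OF m, of "2::nat"] by (auto simp: dimK1_def)
  define n where "n = real (dimK1 m)"
  have np: "n > 0" using n by (simp add: n_def)
  \<comment> \<open>The witness will lie at distance sqrt 2 h < 2 h; the bound 1 / (2 n) keeps its
    coordinates positive.\<close>
  define h where "h = min (min (\<epsilon>1 / 2) (\<epsilon>2 / 2)) (1 / (2 * n))"
  have h: "h > 0" "h \<le> \<epsilon>1 / 2" "h \<le> \<epsilon>2 / 2" "h \<le> 1 / (2 * n)"
    using e1 e2 np by (auto simp: h_def)
  have h1: "h < 1 / n"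
    using np by (intro le_less_trans[OF h(4)]) (simp add: field_simps)
  \<comment> \<open>Moving mass h from coordinate 1 to coordinate 0 keeps the sum equal to
    1.\<close>
  define x where "x = (\<lambda>i::nat. 1 / n + ((if i = 0 then h else 0) - (if i = 1 then h else 0)))"
  define a where "a = (\<lambda>i. r * x i)"
  have xpos: "x i > 0" for i using h h1 np by (auto simp: x_def add_pos_pos)
  have pos: "positive_state m a" using xpos r by (simp add: positive_state_def a_def)
  have "(\<Sum>i<dimK1 m. x i) = 1"
    using n by (simp add: x_def sum.distrib sum_subtractf n_def)
  then have ra: "l1norm m a = r"
    unfolding l1norm_positive[OF pos] by (simp add: a_def flip: sum_distrib_left)
  have dir: "direction m a = x" using r unfolding direction_def ra by (simp add: a_def)
  have dist: "edist m x (uniform_dir m) = sqrt 2 * h"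
  proof -
    have "(\<Sum>i<dimK1 m. (x i - uniform_dir m i)\<^sup>2)
       = (\<Sum>i<dimK1 m. (if i = 0 then h\<^sup>2 else 0) + (if i = 1 then h\<^sup>2 else 0))"
      by (intro sum.cong) (auto simp: x_def uniform_dir_def n_def)
    also have "\<dots> = 2 * h\<^sup>2" using n by (simp add: sum.distrib)
    finally show ?thesis using h by (simp add: edist_def real_sqrt_mult)
  qed
  have "sqrt 2 * h < 2 * h"
    using h by (intro mult_strict_right_mono) (auto simp: real_less_lsqrt)
  then have "sqrt 2 * h < \<epsilon>1" "sqrt 2 * h < \<epsilon>2" using h by linarith+
  then show False
    using st[OF pos ra] un[OF pos ra] h(1) unfolding dir dist by simp
qed

section \<open>Global existence for Lipschitz fields\<close>

text \<open>Banach's fixed point theorem for y t = exp (-k t) (x t - x0): the weight makes the Picard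
  operator a contraction on the whole half-line.\<close>

lemma global_lipschitz_ode_solution:
  fixes f :: "'a::banach \<Rightarrow> 'a"
  assumes lip: "\<And>x y. norm (f x - f y) \<le> C * norm (x - y)"
  obtains x where "x 0 = x0" "\<And>t. t \<ge> 0 \<Longrightarrow> (x has_vector_derivative f (x t)) (at t within {0..})"
proof -
  \<comment> \<open>The Lipschitz constant is at most k / 2 and the weighted integral costs 1 / k,
    which gives the contraction factor 1/2.\<close>
  define k where "k = 2 * \<bar>C\<bar> + 1"
  have k: "k > 0" "2 * \<bar>C\<bar> \<le> k" by (auto simp: k_def)
  have lip': "norm (f x - f y) \<le> (k / 2) * norm (x - y)" for x y
    by (rule order_trans[OF lip], rule mult_right_mono) (use k in auto)
  have fcont: "continuous_on UNIV f"
    by (rule lipschitz_on_continuous_on[of "k / 2"]) (use lip' k in \<open>auto simp: lipschitz_on_def dist_norm\<close>)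
  \<comment> \<open>Undoes the weight: the curve encoded by the bounded function y.\<close>
  define X where "X = (\<lambda>y t. x0 + exp (k * t) *\<^sub>R apply_bcontfun y t :: 'a)"
  have contX: "continuous_on A (\<lambda>s. f (X y s))" for A :: "real set" and y
    unfolding X_def
    by (intro continuous_on_compose2[OF fcont] continuous_intros continuous_on_apply_bcontfun) auto
  \<comment> \<open>Bounded continuous functions live on the whole line, so negative times are
    collapsed to 0.\<close>
  define P where "P = (\<lambda>y t. exp (- k * max 0 t) *\<^sub>R integral {0..max 0 t} (\<lambda>s. f (X y s)))"
  have exp_int: "((\<lambda>s. exp (k * s)) has_integral (exp (k * t) / k - exp (k * 0) / k)) {0..t}" if "t \<ge> 0" for t
    using k that by (intro fundamental_theorem_of_calculus)
      (auto intro!: derivative_eq_intros simp: has_real_derivative_iff_has_vector_derivative[symmetric])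
  have int_le: "exp (- k * t) * integral {0..t} (\<lambda>s. c * exp (k * s)) \<le> c / k" if "t \<ge> 0" "c \<ge> 0" for c t
  proof -
    have "integral {0..t} (\<lambda>s. c * exp (k * s)) = c * (exp (k * t) / k - exp (k * 0) / k)"
      using has_integral_mult_right[OF exp_int[OF that(1)]] by (rule integral_unique)
    then have "exp (- k * t) * integral {0..t} (\<lambda>s. c * exp (k * s)) = c / k * (1 - exp (- k * t))"
      using k by (simp add: exp_minus field_simps)
    also have "\<dots> \<le> c / k * 1"
      using k that by (intro mult_left_mono) auto
    finally show ?thesis by simp
  qed
  have "continuous_on UNIV (\<lambda>t. integral {0..max 0 t} (\<lambda>s. f (X y s)))" for y
  proof (subst continuous_on_eq_continuous_within, intro ballI)
    fix t :: real
    have "continuous_on {0..\<bar>t\<bar> + 1} (\<lambda>u. integral {0..u} (\<lambda>s. f (X y s)))"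
      by (intro indefinite_integral_continuous_1 integrable_continuous_real contX)
    then have "continuous_on {- \<bar>t\<bar> - 1<..<\<bar>t\<bar> + 1} (\<lambda>t. integral {0..max 0 t} (\<lambda>s. f (X y s)))"
      by (rule continuous_on_compose2) (auto intro!: continuous_intros)
    then show "continuous (at t) (\<lambda>t. integral {0..max 0 t} (\<lambda>s. f (X y s)))"
      by (subst (asm) continuous_on_eq_continuous_at) (auto dest!: bspec[where x = t])
  qed
  then have Pcont: "continuous_on UNIV (P y)" for y
    unfolding P_def by (intro continuous_intros)
  have Pb: "norm (P y t) \<le> (norm (f x0) + (k / 2) * norm y) / k" for y t
  proof -
    have "norm (f (X y s)) \<le> (norm (f x0) + (k / 2) * norm y) * exp (k * s)" if "s \<ge> 0" for s
    proof -
      have e: "1 \<le> exp (k * s)" using that k by simp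
      have "norm (f (X y s)) \<le> norm (f x0) + norm (f (X y s) - f x0)" by norm
      also have "norm (f (X y s) - f x0) \<le> (k / 2) * norm (X y s - x0)" by (rule lip')
      also have "norm (X y s - x0) = exp (k * s) * norm (y s)" by (simp add: X_def)
      also have "norm (y s) \<le> norm y" by (rule norm_bounded)
      finally have "norm (f (X y s)) \<le> norm (f x0) * 1 + (k / 2) * (exp (k * s) * norm y)"
        using k by (simp add: mult_left_mono)
      also have "\<dots> \<le> norm (f x0) * exp (k * s) + (k / 2) * (exp (k * s) * norm y)"
        using e k by (intro add_mono mult_left_mono) auto
      finally show ?thesis by (simp add: algebra_simps)
    qed
    then have "norm (integral {0..max 0 t} (\<lambda>s. f (X y s)))
        \<le> integral {0..max 0 t} (\<lambda>s. (norm (f x0) + (k / 2) * norm y) * exp (k * s))"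
      by (intro integral_norm_bound_integral integrable_continuous_real contX continuous_intros) auto
    then have "norm (P y t) \<le> exp (- k * max 0 t)
        * integral {0..max 0 t} (\<lambda>s. (norm (f x0) + (k / 2) * norm y) * exp (k * s))"
      unfolding P_def norm_scaleR by (simp add: mult_left_mono)
    also have "\<dots> \<le> (norm (f x0) + (k / 2) * norm y) / k"
      using k by (intro int_le) auto
    finally show ?thesis .
  qed
  have Pbc: "P y \<in> bcontfun" for y
    by (rule bcontfun_normI[OF Pcont Pb])
  define T where "T = (\<lambda>y. Bcontfun (P y))"
  have T: "apply_bcontfun (T y) = P y" for y
    unfolding T_def by (rule Bcontfun_inverse[OF Pbc])
  have contr: "dist (T y) (T z) \<le> 1/2 * dist y z" for y z
  proof (rule dist_bound)
    fix t :: real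
    let ?t = "max 0 t"
    have "norm (f (X y s) - f (X z s)) \<le> (k / 2 * dist y z) * exp (k * s)" for s
    proof -
      have "norm (f (X y s) - f (X z s)) \<le> (k / 2) * norm (X y s - X z s)" by (rule lip')
      also have "norm (X y s - X z s) = exp (k * s) * dist (y s) (z s)"
        by (simp add: X_def dist_norm flip: scaleR_diff_right)
      also have "(k / 2) * \<dots> \<le> (k / 2) * (exp (k * s) * dist y z)"
        using k by (intro mult_left_mono dist_bounded) auto
      finally show ?thesis by (simp add: mult_ac)
    qed
    then have "norm (integral {0..?t} (\<lambda>s. f (X y s) - f (X z s)))
        \<le> integral {0..?t} (\<lambda>s. (k / 2 * dist y z) * exp (k * s))"
      by (intro integral_norm_bound_integral integrable_continuous_real continuous_intros contX) auto
    moreover have "P y t - P z t = exp (- k * ?t) *\<^sub>R integral {0..?t} (\<lambda>s. f (X y s) - f (X z s))"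
      unfolding P_def
      by (subst integral_diff) (auto intro!: integrable_continuous_real contX simp: scaleR_diff_right)
    ultimately have "dist (P y t) (P z t) \<le> exp (- k * ?t) * integral {0..?t} (\<lambda>s. (k / 2 * dist y z) * exp (k * s))"
      by (simp add: dist_norm mult_left_mono)
    also have "\<dots> \<le> (k / 2 * dist y z) / k"
      using k by (intro int_le) auto
    also have "\<dots> = 1/2 * dist y z" using k by simp
    finally show "dist (T y t) (T z t) \<le> 1/2 * dist y z" by (simp add: T)
  qed
  have "\<exists>!y. T y = y"
    using banach_fix_type[where c = "1/2" and f = T] contr by auto
  then obtain y where y: "T y = y" by blast
  define x where "x = X y"
  have x_eq: "x t = x0 + integral {0..t} (\<lambda>s. f (x s))" if "t \<ge> 0" for t
  proof -
    have "y t = P y t" by (metis T y)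
    then have "x t = x0 + exp (k * t) *\<^sub>R P y t" by (simp add: x_def X_def)
    then show ?thesis using that by (simp add: P_def x_def exp_minus)
  qed
  show ?thesis
  proof (rule that)
    show "x 0 = x0" using x_eq[of 0] by simp
    fix t :: real assume t: "t \<ge> 0"
    \<comment> \<open>The right end lies beyond t, so this compact interval and the half-line define
      the same filter at t.\<close>
    have "((\<lambda>u. integral {0..u} (\<lambda>s. f (x s))) has_vector_derivative f (x t)) (at t within {0..t + 1})"
      unfolding x_def using t by (intro integral_has_vector_derivative contX) auto
    then have "((\<lambda>u. x0 + integral {0..u} (\<lambda>s. f (x s))) has_vector_derivative f (x t)) (at t within {0..t + 1})"
      by (auto intro!: derivative_eq_intros)
    then have "(x has_vector_derivative f (x t)) (at t within {0..t + 1})"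
      by (rule has_vector_derivative_transform[rotated 2]) (use t x_eq in auto)
    moreover have "at t within {0..t + 1} = at t within {0..}"
      by (rule at_within_nhd[of t "{..<t + 1}"]) auto
    ultimately show "(x has_vector_derivative f (x t)) (at t within {0..})" by simp
  qed
qed

section \<open>The planar system\<close>

text \<open>Lipschitz functions alone are not closed under products; together with boundedness they
  are, so the planar field can be assembled from its factors.\<close>

definition bounded_lipschitz :: "('a::real_normed_vector \<Rightarrow> real) \<Rightarrow> bool" where
  "bounded_lipschitz f \<longleftrightarrow> (\<exists>B. (\<forall>x. \<bar>f x\<bar> \<le> B) \<and> (\<forall>x y. \<bar>f x - f y\<bar> \<le> B * norm (x - y)))"

lemma bounded_lipschitzI:
  assumes "\<And>x. \<bar>f x\<bar> \<le> B" "\<And>x y. \<bar>f x - f y\<bar> \<le> C * norm (x - y)"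
  shows "bounded_lipschitz f"
  unfolding bounded_lipschitz_def
proof (intro exI[of _ "max B C"] conjI allI)
  show "\<bar>f x\<bar> \<le> max B C" for x using assms(1)[of x] by simp
  show "\<bar>f x - f y\<bar> \<le> max B C * norm (x - y)" for x y
    by (rule order_trans[OF assms(2)], rule mult_right_mono) auto
qed

lemma bounded_lipschitz_const: "bounded_lipschitz (\<lambda>x. c)"
  by (rule bounded_lipschitzI[of _ "\<bar>c\<bar>" 0]) auto

lemma bounded_lipschitz_add:
  assumes "bounded_lipschitz f" "bounded_lipschitz g"
  shows "bounded_lipschitz (\<lambda>x. f x + g x)"
proof -
  from assms obtain A B where
    A: "\<And>x. \<bar>f x\<bar> \<le> A" "\<And>x y. \<bar>f x - f y\<bar> \<le> A * norm (x - y)" and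
    B: "\<And>x. \<bar>g x\<bar> \<le> B" "\<And>x y. \<bar>g x - g y\<bar> \<le> B * norm (x - y)"
    unfolding bounded_lipschitz_def by blast
  show ?thesis
  proof (rule bounded_lipschitzI)
    show "\<bar>f x + g x\<bar> \<le> A + B" for x using A(1)[of x] B(1)[of x] by linarith
    show "\<bar>(f x + g x) - (f y + g y)\<bar> \<le> (A + B) * norm (x - y)" for x y
      using A(2)[of x y] B(2)[of x y] unfolding distrib_right by linarith
  qed
qed

lemma bounded_lipschitz_mult:
  assumes "bounded_lipschitz f" "bounded_lipschitz g"
  shows "bounded_lipschitz (\<lambda>x. f x * g x)"
proof -
  from assms obtain A B where
    A: "\<And>x. \<bar>f x\<bar> \<le> A" "\<And>x y. \<bar>f x - f y\<bar> \<le> A * norm (x - y)" and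
    B: "\<And>x. \<bar>g x\<bar> \<le> B" "\<And>x y. \<bar>g x - g y\<bar> \<le> B * norm (x - y)"
    unfolding bounded_lipschitz_def by blast
  have AB: "A \<ge> 0" "B \<ge> 0" using A(1)[of 0] B(1)[of 0] by linarith+
  show ?thesis
  proof (rule bounded_lipschitzI)
    show "\<bar>f x * g x\<bar> \<le> A * B" for x
      unfolding abs_mult using A(1) B(1) AB by (intro mult_mono) auto
    show "\<bar>f x * g x - f y * g y\<bar> \<le> (A * B + A * B) * norm (x - y)" for x y
    proof -
      have "f x * g x - f y * g y = f x * (g x - g y) + (f x - f y) * g y" by (simp add: algebra_simps)
      also have "\<bar>\<dots>\<bar> \<le> \<bar>f x\<bar> * \<bar>g x - g y\<bar> + \<bar>f x - f y\<bar> * \<bar>g y\<bar>"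
        by (metis abs_mult abs_triangle_ineq)
      also have "\<dots> \<le> A * (B * norm (x - y)) + (A * norm (x - y)) * B"
        using A B AB by (intro add_mono mult_mono) auto
      finally show ?thesis by (simp add: algebra_simps)
    qed
  qed
qed

lemma bounded_lipschitz_inverse:
  assumes "bounded_lipschitz f" and ge: "\<And>x. f x \<ge> 1"
  shows "bounded_lipschitz (\<lambda>x. inverse (f x))"
proof -
  from assms(1) obtain A where A: "\<And>x y. \<bar>f x - f y\<bar> \<le> A * norm (x - y)"
    unfolding bounded_lipschitz_def by blast
  show ?thesis
  proof (rule bounded_lipschitzI)
    show "\<bar>inverse (f x)\<bar> \<le> 1" for x using ge[of x] by (simp add: inverse_le_1_iff)
    show "\<bar>inverse (f x) - inverse (f y)\<bar> \<le> A * norm (x - y)" for x y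
    proof -
      have f: "f x > 0" "f y > 0" using ge[of x] ge[of y] by linarith+
      have 1: "1 \<le> f x * f y" using mult_mono[OF ge[of x] ge[of y]] f by simp
      have "\<bar>inverse (f x) - inverse (f y)\<bar> = \<bar>f x - f y\<bar> / (f x * f y)"
        using f by (simp add: field_simps abs_mult abs_minus_commute)
      also have "\<dots> \<le> \<bar>f x - f y\<bar> / 1"
        using 1 by (intro divide_left_mono) auto
      finally show ?thesis using A[of x y] by simp
    qed
  qed
qed

text \<open>Mean value inequality on \<open>S\<close>: the bounds on \<phi> and its derivative are
  required only where the clipped argument h takes its values.\<close>

lemma bounded_lipschitz_compose:
  assumes S: "convex S" "\<And>x. h x \<in> S"
    and D: "\<And>s. s \<in> S \<Longrightarrow> (\<phi> has_real_derivative \<phi>' s) (at s)"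
    and B: "\<And>s. s \<in> S \<Longrightarrow> \<bar>\<phi> s\<bar> \<le> B" and C: "\<And>s. s \<in> S \<Longrightarrow> \<bar>\<phi>' s\<bar> \<le> C"
    and h: "\<And>x y. \<bar>h x - h y\<bar> \<le> norm (x - y)"
  shows "bounded_lipschitz (\<lambda>x. \<phi> (h x))"
proof (rule bounded_lipschitzI)
  show "\<bar>\<phi> (h x)\<bar> \<le> B" for x using B S by blast
  \<comment> \<open>Any argument will do: h takes a value in \<open>S\<close>, where C bounds an
    absolute value.\<close>
  have "C \<ge> 0" using C[OF S(2)[of undefined]] by linarith
  show "\<bar>\<phi> (h x) - \<phi> (h y)\<bar> \<le> C * norm (x - y)" for x y
  proof -
    have "norm (\<phi> (h x) - \<phi> (h y)) \<le> C * norm (h x - h y)"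
      by (rule field_differentiable_bound[OF S(1), of \<phi> \<phi>'])
        (auto intro: has_field_derivative_at_within D C simp: S(2))
    also have "\<dots> \<le> C * norm (x - y)"
      using h \<open>C \<ge> 0\<close> by (intro mult_left_mono) auto
    finally show ?thesis by simp
  qed
qed

text \<open>Mean value theorem. With c = 0 it yields monotonicity, with c > 0 it forces u to be
  unbounded.\<close>

lemma growth_of_derivative_ge:
  fixes f :: "real \<Rightarrow> real"
  assumes "\<And>t. t \<ge> 0 \<Longrightarrow> (f has_real_derivative f' t) (at t within {0..})"
    and "0 \<le> a" "a \<le> b" "\<And>t. a \<le> t \<Longrightarrow> t \<le> b \<Longrightarrow> c \<le> f' t"
  shows "f a + c * (b - a) \<le> f b"
proof (cases "a = b")
  case False
  then have "a < b" using assms by simp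
  then obtain s where "s \<in> {a<..<b}" "f b - f a = f' s * (b - a)"
    using mvt_simple[of a b f "\<lambda>t h. f' t * h"] assms(1,2)
    by (smt (verit) atLeastAtMost_iff atLeast_iff has_field_derivative_def has_field_derivative_subset subsetI)
  moreover have "c * (b - a) \<le> f' s * (b - a)"
    using assms(4)[of s] calculation \<open>a < b\<close> by (intro mult_right_mono) auto
  ultimately show ?thesis by linarith
qed simp

text \<open>Here M = K/2, and u, v are the values of the state off and on the index-two subgroup.\<close>

definition block_den :: "real \<Rightarrow> real \<Rightarrow> real \<Rightarrow> real" where
  "block_den M u v = 1 + (2 * M - 2) * exp (- M * (u + v)) + exp (- 2 * M * u)"

text \<open>The character that is trivial on the subgroup produces \<open>exp (- 2 * M * u)\<close>;
  the other 2 M - 2 nontrivial ones all produce \<open>exp (- M * (u + v))\<close>.\<close>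

definition block_u :: "real \<Rightarrow> real \<Rightarrow> real \<Rightarrow> real \<Rightarrow> real" where
  "block_u M p u v = ((2 * M - 2) * exp (- M * (u + v)) + 2 * exp (- 2 * M * u)) * u powr p / block_den M u v"

definition block_v :: "real \<Rightarrow> real \<Rightarrow> real \<Rightarrow> real \<Rightarrow> real" where
  "block_v M p u v = 2 * M * exp (- M * (u + v)) * v powr p / block_den M u v"

lemma block_den_ge_1: "M \<ge> 1 \<Longrightarrow> block_den M u v \<ge> 1"
  by (simp add: block_den_def)

section \<open>Estimates for the factors of the clipped planar field\<close>

lemma square_exp_le: "x \<ge> 0 \<Longrightarrow> x\<^sup>2 * exp (- x) \<le> (2::real)"
  using exp_lower_Taylor_quadratic[of x] by (simp add: exp_minus field_simps)

lemma linear_exp_le: "x * exp (- x) \<le> (1::real)"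
proof -
  have "x \<le> exp x" using exp_ge_add_one_self[of x] by linarith
  then show ?thesis by (simp add: exp_minus field_simps)
qed

text \<open>The power alone is neither bounded nor Lipschitz on [1, \<infinity>). With the
  exponential, the two terms of the derivative each lie between 0 and 2.\<close>

lemma bounded_lipschitz_powr_exp:
  fixes h :: "'a::real_normed_vector \<Rightarrow> real"
  assumes M: "M \<ge> 1" and p: "1 < p" "p < 2"
    and h: "\<And>x y. \<bar>h x - h y\<bar> \<le> norm (x - y)" "\<And>x. h x \<ge> 1"
  shows "bounded_lipschitz (\<lambda>x. h x powr p * exp (- M * h x))"
proof (rule bounded_lipschitz_compose[where \<phi> = "\<lambda>s. s powr p * exp (- M * s)" and h = h
      and \<phi>' = "\<lambda>s. p * s powr (p - 1) * exp (- M * s) - M * (s powr p * exp (- M * s))"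
      and S = "{1..}" and B = 2 and C = 4])
  fix s :: real assume "s \<in> {1..}"
  then have s: "s \<ge> 1" by simp
  show "((\<lambda>s. s powr p * exp (- M * s)) has_real_derivative
      (p * s powr (p - 1) * exp (- M * s) - M * (s powr p * exp (- M * s)))) (at s)"
    using s by (auto intro!: derivative_eq_intros simp: algebra_simps)
  have sp: "s powr p \<le> s\<^sup>2" "s powr (p - 1) \<le> s"
    using s p powr_mono[of p 2 s] powr_mono[of "p - 1" 1 s] by auto
  have Ms: "s \<le> M * s" using M s by simp
  \<comment> \<open>As M is at least 1, the bounds become statements about y = M s and hence are
    uniform in M.\<close>
  have "M * s\<^sup>2 \<le> (M * s)\<^sup>2"
    using M s by (simp add: power_mult_distrib power2_eq_square mult_right_mono)
  then have "M * s\<^sup>2 * exp (- M * s) \<le> (M * s)\<^sup>2 * exp (- (M * s))"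
    by simp
  also have "\<dots> \<le> 2" using M s by (intro square_exp_le) auto
  finally have 1: "M * s\<^sup>2 * exp (- M * s) \<le> 2" .
  have 2: "M * (s powr p * exp (- M * s)) \<le> 2"
    using sp M by (intro order_trans[OF _ 1]) (auto simp: mult_ac intro!: mult_left_mono)
  have 3: "s powr p * exp (- M * s) \<le> M * (s powr p * exp (- M * s))"
    using mult_right_mono[OF M, of "s powr p * exp (- M * s)"] by simp
  then show "\<bar>s powr p * exp (- M * s)\<bar> \<le> 2" using 2 by simp
  have "s * exp (- M * s) \<le> M * s * exp (- (M * s))" using Ms by (simp add: mult_right_mono)
  also have "\<dots> \<le> 1" by (rule linear_exp_le)
  finally have 4: "s * exp (- M * s) \<le> 1" .
  have "p * s powr (p - 1) * exp (- M * s) \<le> 2 * s * exp (- M * s)"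
    using sp p s by (intro mult_mono mult_right_mono) auto
  also have "\<dots> \<le> 2" using 4 by simp
  finally have "p * s powr (p - 1) * exp (- M * s) \<le> 2" .
  moreover have "0 \<le> p * s powr (p - 1) * exp (- M * s)" "0 \<le> M * (s powr p * exp (- M * s))"
    using p M by auto
  ultimately show "\<bar>p * s powr (p - 1) * exp (- M * s) - M * (s powr p * exp (- M * s))\<bar> \<le> 4"
    using 2 by linarith
qed (use h in auto)

lemma bounded_lipschitz_exp:
  fixes h :: "'a::real_normed_vector \<Rightarrow> real"
  assumes M: "M \<ge> 0"
    and h: "\<And>x y. \<bar>h x - h y\<bar> \<le> norm (x - y)" "\<And>x. h x \<ge> 0"
  shows "bounded_lipschitz (\<lambda>x. exp (- M * h x))"
proof (rule bounded_lipschitz_compose[where \<phi> = "\<lambda>s. exp (- M * s)" and h = h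
      and \<phi>' = "\<lambda>s. - M * exp (- M * s)" and S = "{0..}" and B = 1 and C = "M * 1"])
  fix s :: real assume "s \<in> {0..}"
  then have s: "exp (- M * s) \<le> 1" using M by simp
  show "((\<lambda>s. exp (- M * s)) has_real_derivative (- M * exp (- M * s))) (at s)"
    by (auto intro!: derivative_eq_intros)
  show "\<bar>exp (- M * s)\<bar> \<le> 1" using s by simp
  show "\<bar>- M * exp (- M * s)\<bar> \<le> M * 1"
    using M s unfolding abs_mult by (intro mult_mono) auto
qed (use h in auto)

text \<open>p > 1 keeps the derivative of the power bounded near 0.\<close>

lemma bounded_lipschitz_powr:
  fixes h :: "'a::real_normed_vector \<Rightarrow> real"
  assumes p: "1 < p" "p < 2"
    and h: "\<And>x y. \<bar>h x - h y\<bar> \<le> norm (x - y)" "\<And>x. 0 < h x" "\<And>x. h x \<le> 1"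
  shows "bounded_lipschitz (\<lambda>x. h x powr p)"
proof (rule bounded_lipschitz_compose[where \<phi> = "\<lambda>s. s powr p" and h = h
      and \<phi>' = "\<lambda>s. p * s powr (p - 1)" and S = "{0<..1}" and B = 1 and C = "2 * 1"])
  fix s :: real assume "s \<in> {0<..1}"
  then have s: "0 < s" "s \<le> 1" by auto
  show "((\<lambda>s. s powr p) has_real_derivative (p * s powr (p - 1))) (at s)"
    using s by (auto intro!: derivative_eq_intros)
  show "\<bar>s powr p\<bar> \<le> 1" using s p by (simp add: powr_le1)
  have "s powr (p - 1) \<le> 1" using s p by (simp add: powr_le1)
  then show "\<bar>p * s powr (p - 1)\<bar> \<le> 2 * 1"
    using p unfolding abs_mult by (intro mult_mono) auto
qed (use h in auto)

text \<open>A clipped, globally Lipschitz system is solved first; its solution is then shown to stay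
  where clipping is the identity, so it solves the original system.\<close>

lemma block_system_solution:
  fixes M p :: real
  assumes M: "M \<ge> 2" and p: "1 < p" "p < 2"
  obtains u v :: "real \<Rightarrow> real" where
    "\<And>t. t \<ge> 0 \<Longrightarrow> (u has_real_derivative block_u M p (u t) (v t)) (at t within {0..})"
    "\<And>t. t \<ge> 0 \<Longrightarrow> (v has_real_derivative block_v M p (u t) (v t)) (at t within {0..})"
    "\<And>t. t \<ge> 0 \<Longrightarrow> u t \<ge> 1" "\<And>t. t \<ge> 0 \<Longrightarrow> 0 < v t" "\<And>t. t \<ge> 0 \<Longrightarrow> v t \<le> 1"
    "filterlim u at_top at_top"
proof -
  \<comment> \<open>Chosen so that v0^(1-p) = 3: with u(0) = 1 the quantity v^(1-p) - 2 u^(1-p)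
    starts at 1, which keeps v^(1-p) above 1.\<close>
  define v0 :: real where "v0 = 3 powr (- 1 / (p - 1))"
  have v0: "0 < v0" "v0 \<le> 1"
    using p powr_mono[of "- 1 / (p - 1)" 0 3] by (auto simp: v0_def divide_nonpos_pos)
  have v0p: "v0 powr (1 - p) = 3"
  proof -
    have "- 1 / (p - 1) * (1 - p) = 1" using p by (simp add: field_simps)
    then show ?thesis by (simp add: v0_def powr_powr)
  qed
  define cu where "cu = (\<lambda>z :: real \<times> real. max 1 (fst z))"
  define cv where "cv = (\<lambda>z :: real \<times> real. max v0 (min (snd z) 1))"
  have fst_le: "\<bar>fst x - fst y\<bar> \<le> norm (x - y)" and snd_le: "\<bar>snd x - snd y\<bar> \<le> norm (x - y)" for x y :: "real \<times> real"
    using norm_fst_le[of "fst (x - y)" "snd (x - y)"] norm_snd_le[of "snd (x - y)" "fst (x - y)"]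
    unfolding prod.collapse by auto
  have cu: "\<bar>cu x - cu y\<bar> \<le> norm (x - y)" "cu x \<ge> 1" for x y
    using fst_le[of x y] by (auto simp: cu_def)
  have cv: "\<bar>cv x - cv y\<bar> \<le> norm (x - y)" "cv x > 0" "cv x \<le> 1" for x y
    using snd_le[of x y] v0 by (auto simp: cv_def)
  define E1 where "E1 = (\<lambda>z. exp (- M * cu z))"
  define E2 where "E2 = (\<lambda>z. exp (- M * cv z))"
  define P1 where "P1 = (\<lambda>z. cu z powr p * exp (- M * cu z))"
  define P2 where "P2 = (\<lambda>z. cv z powr p)"
  have BL: "bounded_lipschitz E1" "bounded_lipschitz E2" "bounded_lipschitz P1" "bounded_lipschitz P2"
    unfolding E1_def E2_def P1_def P2_def
    by (rule bounded_lipschitz_exp bounded_lipschitz_powr_exp bounded_lipschitz_powr;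
        use M p cu cv order_trans[OF zero_le_one cu(2)] less_imp_le[OF cv(2)] in simp)+
  note BLs = bounded_lipschitz_const bounded_lipschitz_add bounded_lipschitz_mult BL
  have den: "block_den M (cu z) (cv z) = 1 + (2 * M - 2) * (E1 z * E2 z) + E1 z * E1 z" for z
    by (simp add: block_den_def E1_def E2_def exp_add[symmetric] algebra_simps)
  have "bounded_lipschitz (\<lambda>z. block_den M (cu z) (cv z))"
    unfolding den by (intro BLs)
  then have BLi: "bounded_lipschitz (\<lambda>z. inverse (block_den M (cu z) (cv z)))"
    by (rule bounded_lipschitz_inverse) (use M block_den_ge_1 in simp)
  \<comment> \<open>In both summands the unbounded power of u is paired with one exponential factor,
    forming the bounded \<open>P1\<close>.\<close>
  have fu: "block_u M p (cu z) (cv z) = ((2 * M - 2) * (P1 z * E2 z) + 2 * (P1 z * E1 z)) * inverse (block_den M (cu z) (cv z))" for z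
    unfolding block_u_def divide_inverse
    by (simp add: P1_def E1_def E2_def exp_add[symmetric] algebra_simps)
  have fv: "block_v M p (cu z) (cv z) = 2 * M * (E1 z * E2 z * P2 z) * inverse (block_den M (cu z) (cv z))" for z
    unfolding block_v_def divide_inverse
    by (simp add: P2_def E1_def E2_def exp_add[symmetric] algebra_simps)
  define F where "F = (\<lambda>z. (block_u M p (cu z) (cv z), block_v M p (cu z) (cv z)))"
  have "bounded_lipschitz (\<lambda>z. block_u M p (cu z) (cv z))"
    unfolding fu by (intro BLs BLi)
  then obtain A where A: "\<And>x y. \<bar>block_u M p (cu x) (cv x) - block_u M p (cu y) (cv y)\<bar> \<le> A * norm (x - y)"
    unfolding bounded_lipschitz_def by blast
  have "bounded_lipschitz (\<lambda>z. block_v M p (cu z) (cv z))"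
    unfolding fv by (intro BLs BLi)
  then obtain B where B: "\<And>x y. \<bar>block_v M p (cu x) (cv x) - block_v M p (cu y) (cv y)\<bar> \<le> B * norm (x - y)"
    unfolding bounded_lipschitz_def by blast
  have "norm (F x - F y) \<le> (A + B) * norm (x - y)" for x y
  proof -
    have "norm (F x - F y) \<le> \<bar>block_u M p (cu x) (cv x) - block_u M p (cu y) (cv y)\<bar>
        + \<bar>block_v M p (cu x) (cv x) - block_v M p (cu y) (cv y)\<bar>"
      unfolding F_def using norm_Pair_le by (metis diff_Pair real_norm_def)
    also have "\<dots> \<le> (A + B) * norm (x - y)"
      using A[of x y] B[of x y] unfolding distrib_right by linarith
    finally show ?thesis .
  qed
  then obtain z where z0: "z 0 = (1, v0)"
    and z: "\<And>t. t \<ge> 0 \<Longrightarrow> (z has_vector_derivative F (z t)) (at t within {0..})"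
    using global_lipschitz_ode_solution[of F "A + B" "(1, v0)"] by blast
  define u where "u = (\<lambda>t. fst (z t))"
  define v where "v = (\<lambda>t. snd (z t))"
  have du: "(u has_real_derivative block_u M p (cu (z t)) (cv (z t))) (at t within {0..})" if "t \<ge> 0" for t
    using bounded_linear.has_vector_derivative[OF bounded_linear_fst z[OF that]]
    by (simp add: has_real_derivative_iff_has_vector_derivative u_def F_def)
  have dv: "(v has_real_derivative block_v M p (cu (z t)) (cv (z t))) (at t within {0..})" if "t \<ge> 0" for t
    using bounded_linear.has_vector_derivative[OF bounded_linear_snd z[OF that]]
    by (simp add: has_real_derivative_iff_has_vector_derivative v_def F_def)
  have den_pos: "block_den M a b > 0" for a b using block_den_ge_1[of M a b] M by simp
  \<comment> \<open>Nonnegative for all arguments, so u and v never fall below their initial values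
    and the lower clips stay inactive.\<close>
  have nn: "block_u M p a b \<ge> 0" "block_v M p a b \<ge> 0" for a b
    using M den_pos[of a b] by (auto simp: block_u_def block_v_def intro!: divide_nonneg_pos mult_nonneg_nonneg add_nonneg_nonneg)
  have u_mono: "u s \<le> u t" if "0 \<le> s" "s \<le> t" for s t
    using growth_of_derivative_ge[OF du, where a = s and b = t and c = 0] that nn by simp
  have v_mono: "v s \<le> v t" if "0 \<le> s" "s \<le> t" for s t
    using growth_of_derivative_ge[OF dv, where a = s and b = t and c = 0] that nn by simp
  have u1: "u t \<ge> 1" if "t \<ge> 0" for t using u_mono[of 0 t] that z0 by (simp add: u_def)
  have vv0: "v t \<ge> v0" if "t \<ge> 0" for t using v_mono[of 0 t] that z0 by (simp add: v_def)
  have cu_eq: "cu (z t) = u t" if "t \<ge> 0" for t using u1[OF that] by (simp add: cu_def u_def)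
  have cv_le: "cv (z t) \<le> v t" if "t \<ge> 0" for t using vv0[OF that] by (simp add: cv_def v_def)
  \<comment> \<open>The exponent p > 1 makes v' / v^p at most twice u' / u^p,
    hence v^(1-p) - 2 u^(1-p) is nondecreasing and v never reaches 1.\<close>
  have v1: "v t \<le> 1" if t: "t \<ge> 0" for t
  proof -
    define Q' where "Q' = (\<lambda>t. (1 - p) * v t powr (1 - p - 1) * block_v M p (cu (z t)) (cv (z t))
         - 2 * ((1 - p) * u t powr (1 - p - 1) * block_u M p (cu (z t)) (cv (z t))))"
    have "((\<lambda>t. v t powr (1 - p) - 2 * u t powr (1 - p)) has_real_derivative Q' s) (at s within {0..})"
      if s: "s \<ge> 0" for s
      using u1[OF s] vv0[OF s] v0 unfolding Q'_def
      by (intro DERIV_diff DERIV_cmult DERIV_chain2[where f = "\<lambda>x. x powr (1 - p)", OF has_real_derivative_powr] du dv s) auto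
    moreover have "Q' s \<ge> 0" if s: "s \<ge> 0" for s
    proof -
      let ?e = "exp (- M * (cu (z s) + cv (z s)))" and ?g = "exp (- 2 * M * cu (z s))"
      let ?D = "block_den M (cu (z s)) (cv (z s))"
      have us: "u s > 0" and vs: "v s > 0" using u1[OF s] vv0[OF s] v0 by linarith+
      \<comment> \<open>Here v \<le> 1 is not yet known. Clipping can only lower v, which is the
        direction that the comparison needs.\<close>
      have "v s powr (1 - p - 1) * cv (z s) powr p \<le> v s powr (1 - p - 1) * v s powr p"
        using cv_le[OF s] cv(2)[of "z s"] p by (intro mult_left_mono powr_mono2) auto
      also have "\<dots> = 1" using vs by (simp flip: powr_add)
      finally have "2 * M * ?e / ?D * (v s powr (1 - p - 1) * cv (z s) powr p) \<le> 2 * M * ?e / ?D * 1"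
        using M den_pos by (intro mult_left_mono) (auto intro!: divide_nonneg_pos)
      then have 1: "v s powr (1 - p - 1) * block_v M p (cu (z s)) (cv (z s)) \<le> 2 * M * ?e / ?D"
        by (simp add: block_v_def mult_ac)
      have "u s powr (1 - p - 1) * u s powr p = 1" using us by (simp flip: powr_add)
      then have 2: "u s powr (1 - p - 1) * block_u M p (cu (z s)) (cv (z s)) = ((2 * M - 2) * ?e + 2 * ?g) / ?D"
        unfolding block_u_def cu_eq[OF s] by (simp add: mult_ac)
      \<comment> \<open>The factor 2 of the comparison: 2 M \<le> 2 (2 M - 2) holds exactly when M
        \<ge> 2, that is K \<ge> 4.\<close>
      have "2 * M * ?e \<le> 2 * (2 * M - 2) * ?e"
        using M by (intro mult_right_mono) auto
      also have "\<dots> \<le> 2 * ((2 * M - 2) * ?e + 2 * ?g)" by (simp add: algebra_simps)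
      finally have "2 * M * ?e / ?D \<le> 2 * ((2 * M - 2) * ?e + 2 * ?g) / ?D"
        using den_pos by (intro divide_right_mono) (auto intro: less_imp_le)
      then have "0 \<le> (p - 1) * (2 * (u s powr (1 - p - 1) * block_u M p (cu (z s)) (cv (z s)))
          - v s powr (1 - p - 1) * block_v M p (cu (z s)) (cv (z s)))"
        using 1 p unfolding 2 by (intro mult_nonneg_nonneg) auto
      then show ?thesis by (simp add: Q'_def algebra_simps)
    qed
    ultimately have "v 0 powr (1 - p) - 2 * u 0 powr (1 - p) + 0 * (t - 0) \<le> v t powr (1 - p) - 2 * u t powr (1 - p)"
      using t by (intro growth_of_derivative_ge[where f' = Q']) auto
    then have "1 \<le> v t powr (1 - p) - 2 * u t powr (1 - p)"
      by (simp add: u_def v_def z0 v0p)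
    moreover have "u t powr (1 - p) > 0" using u1[OF t] by simp
    ultimately have "v t powr (1 - p) > 1" by linarith
    then show ?thesis
      using powr_mono[of "1 - p" 0 "v t"] p by (cases "v t \<le> 1") auto
  qed
  have cv_eq: "cv (z t) = v t" if "t \<ge> 0" for t using vv0[OF that] v1[OF that] by (simp add: cv_def v_def)
  have unbounded: "\<exists>t\<ge>0. u t \<ge> b" for b
  proof (rule ccontr)
    assume "\<not> ?thesis"
    then have ub: "u t < b" if "t \<ge> 0" for t using that by force
    \<comment> \<open>While u < b, the numerator of u' is at least 2 exp (- 2 M b) and the
      denominator at most 2 M. At speed c, time b / c is enough to reach b.\<close>
    define c where "c = 2 * exp (- 2 * M * b) / (2 * M)"
    have c: "c > 0" using M by (simp add: c_def)
    have b: "b > 1" using ub[of 0] u1[of 0] by simp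
    have "c \<le> block_u M p (cu (z t)) (cv (z t))" if t: "t \<ge> 0" for t
    proof -
      have D: "block_den M (u t) (v t) \<le> 2 * M"
      proof -
        have "exp (- M * (u t + v t)) \<le> 1" "exp (- 2 * M * u t) \<le> 1"
          using M u1[OF t] vv0[OF t] v0 by auto
        then have "block_den M (u t) (v t) \<le> 1 + (2 * M - 2) * 1 + 1"
          unfolding block_den_def using M by (intro add_mono mult_left_mono) auto
        then show ?thesis by simp
      qed
      have "2 * exp (- 2 * M * b) * 1 \<le> (2 * exp (- 2 * M * u t)) * u t powr p"
        using ub[OF t] u1[OF t] M p by (intro mult_mono) (auto simp: ge_one_powr_ge_zero)
      also have "\<dots> \<le> ((2 * M - 2) * exp (- M * (u t + v t)) + 2 * exp (- 2 * M * u t)) * u t powr p"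
        using M by (intro mult_right_mono) auto
      finally have "c \<le> ((2 * M - 2) * exp (- M * (u t + v t)) + 2 * exp (- 2 * M * u t)) * u t powr p / block_den M (u t) (v t)"
        unfolding c_def using D den_pos[of "u t" "v t"] M by (intro frac_le) auto
      then show ?thesis by (simp add: block_u_def cu_eq[OF t] cv_eq[OF t])
    qed
    then have "u 0 + c * (b / c - 0) \<le> u (b / c)"
      using b c by (intro growth_of_derivative_ge[OF du]) auto
    then have "u (b / c) \<ge> b" using u1[of 0] c by simp
    then show False using ub[of "b / c"] b c by simp
  qed
  show ?thesis
  proof (rule that[of u v])
    show "filterlim u at_top at_top"
      unfolding filterlim_at_top
    proof
      fix b
      obtain t where t: "t \<ge> 0" "u t \<ge> b" using unbounded by blast
      show "eventually (\<lambda>s. b \<le> u s) at_top"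
        using eventually_ge_at_top[of t]
        by eventually_elim (use t u_mono order_trans in blast)
    qed
    show "0 < v t" if "t \<ge> 0" for t using vv0[OF that] v0 by linarith
  qed (use du dv cu_eq cv_eq u1 v1 in auto)
qed

section \<open>Block states\<close>

text \<open>Position i stands for the matrix index i + 1, and the indices below \<open>2^k\<close>
  form the index-two subgroup.\<close>

definition block_state :: "nat \<Rightarrow> real \<Rightarrow> real \<Rightarrow> nat \<Rightarrow> real" where
  "block_state k u v i = (if i + 1 < 2^k then v else u)"

text \<open>Each half of row j is, up to sign, a row one level down; its sum vanishes unless that
  row is row 0, which for j > 0 means j = 2^k.\<close>

lemma sylv_half_row_sums:
  assumes "0 < j" "j < 2^Suc k"
  shows "(\<Sum>i<2^k. sylv (Suc k) j i) = (if j = 2^k then 2^k else 0)"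
    and "(\<Sum>i<2^k. sylv (Suc k) j (2^k + i)) = (if j = 2^k then - (2^k) else 0)"
proof -
  have *: "(\<Sum>i<2^k. sylv k j i) = 0" if "j < 2^k"
    using sylv_row_sum[OF that] assms by simp
  have **: "(\<Sum>i<2^k. sylv k (j - 2^k) i) = (if j = 2^k then 2^k else 0)" if "\<not> j < 2^k"
    using sylv_row_sum[of "j - 2^k" k] that assms by auto
  show "(\<Sum>i<2^k. sylv (Suc k) j i) = (if j = 2^k then 2^k else 0)"
    using * ** by (cases "j < 2^k") auto
  show "(\<Sum>i<2^k. sylv (Suc k) j (2^k + i)) = (if j = 2^k then - (2^k) else 0)"
    using * ** by (cases "j < 2^k") (auto simp: sum_negf)
qed

lemma Psi_a_block_state:
  assumes "j < dimK1 (Suc k)"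
  shows "Psi_a (Suc k) (block_state k u v) j = (if j + 1 = 2^k then 2 * 2^k * u else 2^k * (u + v))"
proof -
  let ?A = "\<lambda>i::nat. if i < 2^k then v else u"
  have j: "0 < j + 1" "j + 1 < 2^Suc k" using assms by (auto simp: less_dimK1_iff)
  have "Psi_a (Suc k) (block_state k u v) j = (\<Sum>i<2^Suc k. (1 - sylv (Suc k) (j + 1) i) * ?A i)"
    unfolding Psi_a_def Psi_def block_state_def
    by (rule sum_dimK1_shift[where f = "\<lambda>i. (1 - sylv (Suc k) (j + 1) i) * ?A i"]) (simp del: sylv.simps)
  also have "\<dots> = (\<Sum>i<2^k. (1 - sylv (Suc k) (j + 1) i) * ?A i)
      + (\<Sum>i<2^k. (1 - sylv (Suc k) (j + 1) (2^k + i)) * ?A (2^k + i))"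
    unfolding power_Suc by (rule sum_lessThan_double)
  also have "(\<Sum>i<2^k. (1 - sylv (Suc k) (j + 1) i) * ?A i)
      = (\<Sum>i<2^k. 1 - sylv (Suc k) (j + 1) i) * v"
    unfolding sum_distrib_right by (intro sum.cong) (auto simp del: sylv.simps)
  also have "(\<Sum>i<2^k. (1 - sylv (Suc k) (j + 1) (2^k + i)) * ?A (2^k + i))
      = (\<Sum>i<2^k. 1 - sylv (Suc k) (j + 1) (2^k + i)) * u"
    unfolding sum_distrib_right by (intro sum.cong) (auto simp del: sylv.simps)
  finally show ?thesis
    unfolding sum_subtractf sylv_half_row_sums[OF j] by (auto simp: algebra_simps)
qed

lemma exp_Psi_a_block_state:
  fixes u v :: real and k :: nat
  defines "e \<equiv> exp (- (2^k) * (u + v))" and "g \<equiv> exp (- 2 * 2^k * u)"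
  assumes "j < dimK1 (Suc k)"
  shows "exp (- Psi_a (Suc k) (block_state k u v) j) = e + (if j = 2^k - 1 then g - e else 0)"
proof -
  have "j + 1 = 2^k \<longleftrightarrow> j = 2^k - 1" by (auto simp: le_add_diff_inverse2)
  then show ?thesis unfolding Psi_a_block_state[OF assms(3)] by (simp add: e_def g_def)
qed

text \<open>The exponentials agree except at the position of index 2^k, so b_i is a constant plus a
  multiple of one entry of \<open>Psi\<close>. That entry is 0 on the subgroup and 2 off it, hence
  the plane is invariant.\<close>

lemma field_block_state:
  fixes u v :: real and k L :: nat
  assumes i: "i < dimK1 (Suc k)"
  defines "p \<equiv> 2 * real L / (real L + 1)"
  shows "field (Suc k) L (block_state k u v) i =
    (if i + 1 < 2^k then block_v (2^k) p u v else block_u (2^k) p u v)"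
proof -
  define e where "e = exp (- (2^k) * (u + v))"
  define g where "g = exp (- 2 * 2^k * u)"
  have E: "exp (- Psi_a (Suc k) (block_state k u v) j) = e + (if j = 2^k - 1 then g - e else 0)"
    if "j < dimK1 (Suc k)" for j
    using exp_Psi_a_block_state[OF that] by (simp add: e_def g_def)
  have h: "2^k - 1 < dimK1 (Suc k)" by (simp add: dimK1_def diff_less_mono)
  have D: "Dnorm (Suc k) (block_state k u v) = block_den (2^k) u v"
  proof -
    have "(\<Sum>j<dimK1 (Suc k). exp (- Psi_a (Suc k) (block_state k u v) j))
        = (\<Sum>j<dimK1 (Suc k). e + (if j = 2^k - 1 then g - e else 0))"
      by (intro sum.cong) (auto simp: E)
    also have "\<dots> = (2 * 2^k - 1) * e + (g - e)"
      using h by (simp add: sum.distrib real_dimK1)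
    finally show ?thesis
      by (simp add: Dnorm_def block_den_def e_def g_def algebra_simps)
  qed
  have Ps: "Psi (Suc k) i (2^k - 1) = (if i + 1 < 2^k then 0 else 2)"
    by (auto simp: Psi_def)
  have b: "bvec (Suc k) (block_state k u v) i = 2 * 2^k * e + Psi (Suc k) i (2^k - 1) * (g - e)"
  proof -
    have "bvec (Suc k) (block_state k u v) i
        = (\<Sum>j<dimK1 (Suc k). Psi (Suc k) i j * e + (if j = 2^k - 1 then Psi (Suc k) i j * (g - e) else 0))"
      unfolding bvec_def by (intro sum.cong) (auto simp: E algebra_simps)
    then show ?thesis
      using h Psi_row_sum[OF i] by (simp add: sum.distrib flip: sum_distrib_right)
  qed
  show ?thesis
    unfolding field_def D b Ps p_def[symmetric]
    by (auto simp: block_state_def block_v_def block_u_def e_def g_def algebra_simps)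
qed

text \<open>Every logarithm in the KL term is at most 0, and the one at coordinate 0 is at most - ln
  u because v \<le> 1 while the l1 norm is at least u. This bounds the KL term below by ln u / n
  minus a constant.\<close>

lemma diverging_trajectory:
  assumes m: "m \<ge> 2" and L: "L > 1"
  obtains x where "trajectory m L x"
    "filterlim (\<lambda>t. KL_unif m (direction m (x t))) at_top at_top"
proof -
  obtain k where mk: "m = Suc k" and k: "k \<ge> 1" using m by (cases m) auto
  define p where "p = 2 * real L / (real L + 1)"
  have p: "1 < p" "p < 2" using L by (auto simp: p_def field_simps)
  have M: "(2::real) \<le> 2^k" using power_increasing[OF k, of "2::real"] by simp
  obtain u v where
    du: "\<And>t. t \<ge> 0 \<Longrightarrow> (u has_real_derivative block_u (2^k) p (u t) (v t)) (at t within {0..})" and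
    dv: "\<And>t. t \<ge> 0 \<Longrightarrow> (v has_real_derivative block_v (2^k) p (u t) (v t)) (at t within {0..})" and
    u1: "\<And>t. t \<ge> 0 \<Longrightarrow> u t \<ge> 1" and v0: "\<And>t. t \<ge> 0 \<Longrightarrow> 0 < v t" and v1: "\<And>t. t \<ge> 0 \<Longrightarrow> v t \<le> 1" and
    lim: "filterlim u at_top at_top"
    using block_system_solution[OF M p] by metis
  define x where "x = (\<lambda>t. block_state k (u t) (v t))"
  have pos: "positive_state m (x t)" if "t \<ge> 0" for t
    using u1[OF that] v0[OF that] by (auto simp: positive_state_def x_def block_state_def)
  define n where "n = dimK1 m"
  have two: "(2::nat) \<le> 2^k" using power_increasing[OF k, of "2::nat"] by simp
  have n: "0 < n" "2^k - 1 < n" using two by (auto simp: n_def dimK1_def mk)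
  show ?thesis
  proof (rule that)
    show "trajectory m L x"
      unfolding trajectory_def
    proof (intro conjI allI impI)
      show "positive_state m (x 0)" by (rule pos) simp
      fix t :: real and i assume t: "0 \<le> t" and i: "i < dimK1 m"
      show "((\<lambda>s. x s i) has_real_derivative field m L (x t) i) (at t within {0..})"
        using du[OF t] dv[OF t] i field_block_state[of i k L "u t" "v t"]
        by (cases "i + 1 < 2^k") (simp_all add: x_def block_state_def[of k _ _ i] mk p_def)
    qed
    have "- ln (real n) + 1 / real n * ln (u t) \<le> KL_unif m (direction m (x t))" if t: "t \<ge> 0" for t
    proof -
      define l where "l = l1norm m (x t)"
      have le: "x t i \<le> l" if "i < n" for i
        unfolding l_def l1norm_positive[OF pos[OF t]] using that pos[OF t]
        by (intro member_le_sum) (auto simp: n_def positive_state_def less_imp_le)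
      have xp: "x t i > 0" if "i < n" for i
        using that pos[OF t] by (simp add: n_def positive_state_def)
      have lpos: "l > 0" using le[OF n(1)] xp[OF n(1)] by linarith
      have ln_nonpos: "ln (x t i / l) \<le> 0" if "i < n" for i
        using le[OF that] xp[OF that] lpos by (intro ln_le_zero_iff[THEN iffD2]) auto
      \<comment> \<open>Uses k \<ge> 1: the subgroup then has a nonzero element, so the value v
        occurs.\<close>
      have x0: "x t 0 = v t" using two by (simp add: x_def block_state_def)
      \<comment> \<open>This position stands for index 2^k, the first one outside the
        subgroup.\<close>
      have "x t (2^k - 1) = u t" by (simp add: x_def block_state_def)
      then have ul: "u t \<le> l" using le[OF n(2)] by simp
      have "x t 0 / l \<le> 1 / u t"
        unfolding x0 using ul u1[OF t] v1[OF t] by (intro frac_le) auto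
      then have "ln (x t 0 / l) \<le> ln (1 / u t)"
        using xp[OF n(1)] lpos u1[OF t] by (intro ln_mono) auto
      then have ln0: "ln (x t 0 / l) \<le> - ln (u t)" using u1[OF t] by (simp add: ln_div)
      have "(\<Sum>i<n. ln (x t i / l)) = ln (x t 0 / l) + (\<Sum>i\<in>{..<n} - {0}. ln (x t i / l))"
        using n by (intro sum.remove) auto
      also have "(\<Sum>i\<in>{..<n} - {0}. ln (x t i / l)) \<le> 0"
        using ln_nonpos by (intro sum_nonpos) auto
      finally have "(\<Sum>i<n. ln (x t i / l)) \<le> - ln (u t)" using ln0 by simp
      then have "1 / real n * ln (u t) \<le> 1 / real n * (- (\<Sum>i<n. ln (x t i / l)))"
        by (intro mult_left_mono) auto
      then show ?thesis by (simp add: KL_unif_def n_def direction_def l_def)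
    qed
    then have ev: "eventually (\<lambda>t. - ln (real n) + 1 / real n * ln (u t) \<le> KL_unif m (direction m (x t))) at_top"
      by (intro eventually_mono[OF eventually_ge_at_top[of 0]])
    have "filterlim (\<lambda>t. 1 / real n * ln (u t)) at_top at_top"
      using n by (intro filterlim_tendsto_pos_mult_at_top[OF tendsto_const]
          filterlim_compose[OF ln_at_top lim]) auto
    then have "filterlim (\<lambda>t. - ln (real n) + 1 / real n * ln (u t)) at_top at_top"
      by (intro filterlim_tendsto_add_at_top[OF tendsto_const])
    then show "filterlim (\<lambda>t. KL_unif m (direction m (x t))) at_top at_top"
      using ev by (rule filterlim_at_top_mono)
  qed
qed

theorem theorem4p3:
  fixes m L :: nat
  assumes "m \<ge> 2" and "L \<ge> 1"
  shows "stable_in m L (uniform_dir m)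
           {r. r > (real L - 1) / (real L + 1) * real (dimK1 m)}
       \<and> unstable_in m L (uniform_dir m)
           {r. 0 < r \<and> r < (real L - 1) / (real L + 1) * real (dimK1 m)}
       \<and> (L > 1 \<longrightarrow> (\<exists>astar \<tau>. is_direction m astar \<and> (\<exists>i<dimK1 m. astar i = 0)
                         \<and> \<tau> > 0 \<and> stable_in m L astar {r. r > \<tau>}))
       \<and> (L > 1 \<longrightarrow>
            (\<exists>x. trajectory m L x \<and> (\<exists>t1 t2. 0 \<le> t1 \<and> t1 < t2 \<and>
                 KL_unif m (direction m (x t1)) < KL_unif m (direction m (x t2))))
          \<and> (\<exists>x. trajectory m L x \<and>
                 filterlim (\<lambda>t. KL_unif m (direction m (x t))) at_top at_top))"
proof (intro conjI impI)
  show "stable_in m L (uniform_dir m) {r. r > (real L - 1) / (real L + 1) * real (dimK1 m)}"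
    unfolding stable_in_def using uniform_dir_stable[OF assms] by blast
  show "unstable_in m L (uniform_dir m) {r. 0 < r \<and> r < (real L - 1) / (real L + 1) * real (dimK1 m)}"
    unfolding unstable_in_def using uniform_dir_unstable[OF assms(1)] by blast
next
  assume L: "L > 1"
  let ?s = "\<lambda>i::nat. if i = 0 then 1 else 0 :: real"
  have n: "0 < dimK1 m" "1 < dimK1 m"
    using power_increasing[OF assms(1), of "2::nat"] by (auto simp: dimK1_def)
  have "is_direction m ?s" using n by (simp add: is_direction_def)
  moreover have "\<exists>i<dimK1 m. ?s i = 0" using n by (intro exI[of _ 1]) auto
  \<comment> \<open>The vertex is stable for every positive norm, so the threshold 1 is an arbitrary
    choice.\<close>
  moreover have "stable_in m L ?s {r. r > 1}"
    unfolding stable_in_def using vertex_direction_stable[OF assms(1) L] by simp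
  ultimately show "\<exists>astar \<tau>. is_direction m astar \<and> (\<exists>i<dimK1 m. astar i = 0)
                         \<and> \<tau> > 0 \<and> stable_in m L astar {r. r > \<tau>}"
    by (intro exI[of _ ?s] exI[of _ "1::real"]) simp
next
  assume L: "L > 1"
  obtain x where x: "trajectory m L x"
    "filterlim (\<lambda>t. KL_unif m (direction m (x t))) at_top at_top"
    using diverging_trajectory[OF assms(1) L] by blast
  then show "\<exists>x. trajectory m L x \<and> filterlim (\<lambda>t. KL_unif m (direction m (x t))) at_top at_top" by blast
  \<comment> \<open>The diverging trajectory also refutes monotone decrease: its KL term eventually
    exceeds the initial value.\<close>
  have "eventually (\<lambda>t. KL_unif m (direction m (x 0)) < KL_unif m (direction m (x t)) \<and> 0 < t) at_top"
    using x(2) eventually_gt_at_top[of "0::real"] unfolding filterlim_at_top_dense by (auto intro: eventually_conj)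
  then obtain t where "KL_unif m (direction m (x 0)) < KL_unif m (direction m (x t))" "0 < t"
    using eventually_happens by force
  then show "\<exists>x. trajectory m L x \<and> (\<exists>t1 t2. 0 \<le> t1 \<and> t1 < t2 \<and>
                 KL_unif m (direction m (x t1)) < KL_unif m (direction m (x t2)))"
    using x(1) by (metis order_refl)
qed

end
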